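(* Let $L_a^2$ be the Bergman space on the unit disk $\mathbb{D}$, let $L$ be a bounded linear operator on $L_a^2$, and let $\{\lambda_n\}_{n=1}^{\infty}\subset \mathbb{D}$ be a sequence of distinct points. Put $k_{\lambda}(z)=\frac{1-|\lambda|^2}{(1-\overline{\lambda}z)^2}$ for $\lambda,z\in\mathbb{D}$. The following are equivalent: (i) $\{k_{\lambda_n}\}_{n=1}^{\infty}$ is an atomic system for $L$, i.e. the series $\sum_{n=1}^{\infty} c_n\frac{1-|\lambda_n|^2}{(1-\overline{\lambda_n} z)^2}$ converges in $L_a^2$ for all $\{c_n\}\in l^2$, and there exists a constant $C>0$ such that for every $f\in L_a^2$ there exists $a_f=(a_n)\in l^2$ with $\|a_f\|_{l^2}\leq C\|f\|$ and $Lf(z)=\sum_{n=1}^{\infty} a_n\frac{1-|\lambda_n|^2}{(1-\overline{\lambda_n} z)^2}$; (ii) $\{\lambda_n\}_{n=1}^{\infty}$ is a sampling sequence for $L$, i.e. there exist constants $A,B>0$ such that $$A\|L^*f\|^2\leq\sum_{n=1}^{\infty}|f(\lambda_n)|^2(1-|\lambda_n|^2)^2\leq B\|f\|^2\quad\text{for all } f\in L_a^2;$$ (iii) $\{k_{\lambda_n}\}_{n=1}^{\infty}$ is a Bessel sequence and there exists a Bessel sequence $\{g_n\}_{n=1}^{\infty}\subset L_a^2$ such that $$Lf(z)=\sum_{n=1}^{\infty}\langle f,g_n\rangle \frac{1-|\lambda_n|^2}{(1-\overline{\lambda_n} z)^2}\quad\text{for all } f\in L_a^2;$$ (iv) $\sum_{n=1}^{\infty}(1-|\lambda_n|^2)^2|f(\lambda_n)|^2<\infty$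 for all $f\in L_a^2$, and there exists a Bessel sequence $\{g_n\}_{n=1}^{\infty}\subset L_a^2$ such that $$L^*f=\sum_{n=1}^{\infty}(1-|\lambda_n|^2)f(\lambda_n)g_n\quad\text{for all } f\in L_a^2.$$
   Context: $\mathbb{D}=\{z\in\mathbb{C}:|z|<1\}$ and $dA(z)=\frac{1}{\pi}dx\,dy$ is normalized area measure on $\mathbb{D}$. The Bergman space $L_a^2$ is the Hilbert space of analytic functions in $L^2(\mathbb{D},dA)$, with inner product $\langle f,g\rangle=\int_{\mathbb{D}}f\overline{g}\,dA$. It is a reproducing kernel Hilbert space with kernel $K_\lambda(z)=\frac{1}{(1-\overline{\lambda}z)^2}$, i.e. $f(\lambda)=\langle f,K_\lambda\rangle$, and $k_\lambda=K_\lambda/\|K_\lambda\|$ is its normalized kernel. $L^*$ is the Hilbert space adjoint of $L$. Series of functions (including those written pointwise in $z$) converge in the norm of the space. A sequence $\{f_n\}_{n=1}^{\infty}$ in a Hilbert space $\mathcal{H}$ is a Bessel sequence if there is a constant $B>0$ such that $\sum_{n=1}^{\infty}|\langle x,f_n\rangle|^2\leq B\|x\|^2$ for all $x\in\mathcal{H}$. *)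

theory Defs
  imports "HOL-Analysis.Analysis"
begin

definition disc_area :: "complex measure" where
  "disc_area = density lborel (\<lambda>z. ennreal (indicator (ball 0 1) z / pi))"

text \<open>
  Functions on the disc are represented by total functions that vanish off the disc, so that
  equality of functions on the disc is equality in HOL.
\<close>

definition bergman_carrier :: "(complex \<Rightarrow> complex) set" where
  "bergman_carrier = {f. f holomorphic_on ball 0 1 \<and> (\<forall>z. z \<notin> ball 0 1 \<longrightarrow> f z = 0) \<and>
     integrable disc_area (\<lambda>z. (cmod (f z))\<^sup>2)}"

lemma sets_disc_area [simp, measurable_cong]: "sets disc_area = sets borel"
  by (simp add: disc_area_def)

lemma space_disc_area [simp]: "space disc_area = UNIV"
  by (simp add: disc_area_def)

lemma emeasure_disc_area_finite: "emeasure disc_area UNIV < \<infinity>"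
proof -
  have density_measurable:
    "(\<lambda>z::complex. ennreal (indicator (ball 0 1) z / pi)) \<in> borel_measurable lborel"
    by (intro measurable_compose[OF _ measurable_ennreal] borel_measurable_divide
          borel_measurable_indicator) auto
  have "emeasure disc_area UNIV = (\<integral>\<^sup>+z. ennreal (1 / pi) * indicator (ball 0 1) (z::complex) \<partial>lborel)"
    unfolding disc_area_def
    by (subst emeasure_density[OF density_measurable])
       (auto intro!: nn_integral_cong simp del: mem_ball mem_ball_0 simp: indicator_def)
  also have "\<dots> = ennreal (1 / pi) * emeasure lborel (ball (0::complex) 1)"
    by (subst nn_integral_cmult_indicator) auto
  also have "\<dots> < \<infinity>"
    using emeasure_lborel_ball_finite[of "0::complex" 1] by (auto intro: ennreal_mult_less_top[THEN iffD2])
  finally show ?thesis .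
qed

interpretation disc_area: finite_measure disc_area
  using emeasure_disc_area_finite by (intro finite_measureI) auto

lemma bergman_carrier_borel:
  assumes "f \<in> bergman_carrier"
  shows "f \<in> borel_measurable borel"
proof -
  have "(\<lambda>z. if z \<in> ball 0 1 then f z else 0) \<in> borel_measurable borel"
    using assms
    by (intro borel_measurable_continuous_on_if)
       (auto simp: bergman_carrier_def intro!: holomorphic_on_imp_continuous_on)
  also have "(\<lambda>z. if z \<in> ball 0 1 then f z else 0) = f"
    using assms by (auto simp: bergman_carrier_def)
  finally show ?thesis .
qed

lemma bergman_carrier_zero: "(\<lambda>_. 0) \<in> bergman_carrier"
  by (auto simp: bergman_carrier_def)

lemma bergman_carrier_add:
  assumes "f \<in> bergman_carrier" "g \<in> bergman_carrier"
  shows "(\<lambda>z. f z + g z) \<in> bergman_carrier"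
proof -
  note [measurable] = bergman_carrier_borel[OF assms(1)] bergman_carrier_borel[OF assms(2)]
  have int: "integrable disc_area (\<lambda>z. 2 * (cmod (f z))\<^sup>2 + 2 * (cmod (g z))\<^sup>2)"
    using assms by (auto simp: bergman_carrier_def)
  have "norm ((cmod (f z + g z))\<^sup>2) \<le> norm (2 * (cmod (f z))\<^sup>2 + 2 * (cmod (g z))\<^sup>2)" for z
  proof -
    have "(cmod (f z + g z))\<^sup>2 \<le> (cmod (f z) + cmod (g z))\<^sup>2"
      by (intro power_mono norm_triangle_ineq) auto
    also have "\<dots> \<le> 2 * (cmod (f z))\<^sup>2 + 2 * (cmod (g z))\<^sup>2"
      using zero_le_power2[of "cmod (f z) - cmod (g z)"] by (simp add: power2_sum power2_diff)
    finally show ?thesis by simp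
  qed
  then have "integrable disc_area (\<lambda>z. (cmod (f z + g z))\<^sup>2)"
    by (intro Bochner_Integration.integrable_bound[OF int] AE_I2) measurable
  with assms show ?thesis by (auto simp: bergman_carrier_def intro!: holomorphic_intros)
qed

lemma bergman_carrier_scale:
  assumes "f \<in> bergman_carrier"
  shows "(\<lambda>z. c * f z) \<in> bergman_carrier"
  using assms by (auto simp: bergman_carrier_def norm_mult power_mult_distrib intro!: holomorphic_intros)

lemma bergman_carrier_integrable_mult:
  assumes "f \<in> bergman_carrier" "g \<in> bergman_carrier"
  shows "integrable disc_area (\<lambda>z. f z * cnj (g z))"
proof -
  note [measurable] = bergman_carrier_borel[OF assms(1)] bergman_carrier_borel[OF assms(2)]
  have int: "integrable disc_area (\<lambda>z. (cmod (f z))\<^sup>2 + (cmod (g z))\<^sup>2)"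
    using assms by (auto simp: bergman_carrier_def)
  have "norm (f z * cnj (g z)) \<le> norm ((cmod (f z))\<^sup>2 + (cmod (g z))\<^sup>2)" for z
  proof -
    have "0 \<le> cmod (f z) * cmod (g z)" by simp
    then show ?thesis
      using zero_le_power2[of "cmod (f z) - cmod (g z)"]
      unfolding power2_diff norm_mult complex_mod_cnj real_norm_def by linarith
  qed
  moreover have [measurable]: "(\<lambda>z. cnj (g z)) \<in> borel_measurable borel"
    by (rule borel_measurable_continuous_on[OF _ bergman_carrier_borel[OF assms(2)]])
       (intro continuous_intros)
  ultimately show ?thesis
    by (intro Bochner_Integration.integrable_bound[OF int] AE_I2) measurable
qed

lemma bergman_carrier_eq_0:
  assumes "f \<in> bergman_carrier" "(LINT z|disc_area. (cmod (f z))\<^sup>2) = 0"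
  shows "f z = 0"
proof (rule ccontr)
  assume nz: "f z \<noteq> 0"
  note [measurable] = bergman_carrier_borel[OF assms(1)]
  have z: "z \<in> ball 0 1" using assms nz by (auto simp: bergman_carrier_def)
  have "AE w in disc_area. (cmod (f w))\<^sup>2 = 0"
    using assms by (subst (asm) integral_nonneg_eq_0_iff_AE) (auto simp: bergman_carrier_def)
  then have ae: "AE w in lborel. w \<in> ball 0 1 \<longrightarrow> f w = 0"
    unfolding disc_area_def by (subst (asm) AE_density) (auto simp: indicator_def elim!: eventually_mono)
  have "continuous_on (ball 0 1) f"
    using assms by (auto simp: bergman_carrier_def intro: holomorphic_on_imp_continuous_on)
  then have "open {w \<in> ball 0 1. f w \<in> - {0}}"
    by (intro continuous_open_preimage[unfolded vimage_def Int_def, simplified]) auto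
  then obtain e where e: "e > 0" "ball z e \<subseteq> {w \<in> ball 0 1. f w \<noteq> 0}"
    using z nz by (auto simp: open_contains_ball)
  have "AE w in lborel. w \<notin> ball z e"
    using ae by eventually_elim (use e in auto)
  then have "emeasure lborel (ball z e) = 0"
    by (subst (asm) AE_iff_measurable[of "ball z e"]) auto
  then have "measure lborel (ball z e) = 0" by (simp add: measure_def)
  then show False using content_ball_pos[OF e(1), of z] by simp
qed

typedef bergman = bergman_carrier
  morphisms bergman_apply Abs_bergman
  using bergman_carrier_zero by blast

setup_lifting type_definition_bergman

instantiation bergman :: ab_group_add
begin

lift_definition zero_bergman :: bergman is "\<lambda>_. 0"
  by (rule bergman_carrier_zero)

lift_definition plus_bergman :: "bergman \<Rightarrow> bergman \<Rightarrow> bergman" is "\<lambda>f g z. f z + g z"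
  by (rule bergman_carrier_add)

lift_definition uminus_bergman :: "bergman \<Rightarrow> bergman" is "\<lambda>f z. - f z"
  using bergman_carrier_scale[of _ "-1"] by simp

lift_definition minus_bergman :: "bergman \<Rightarrow> bergman \<Rightarrow> bergman" is "\<lambda>f g z. f z - g z"
  using bergman_carrier_add[OF _ bergman_carrier_scale[of _ "-1"]] by simp

instance by standard (transfer; simp add: fun_eq_iff)+

end

lift_definition scaleC :: "complex \<Rightarrow> bergman \<Rightarrow> bergman" (infixr "*\<^sub>C" 75) is "\<lambda>c f z. c * f z"
  by (rule bergman_carrier_scale)

lift_definition cinner :: "bergman \<Rightarrow> bergman \<Rightarrow> complex" is
  "\<lambda>f g. LINT z|disc_area. f z * cnj (g z)" .

instantiation bergman :: real_inner
begin

definition scaleR_bergman :: "real \<Rightarrow> bergman \<Rightarrow> bergman" where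
  "scaleR_bergman r f = of_real r *\<^sub>C f"

definition inner_bergman :: "bergman \<Rightarrow> bergman \<Rightarrow> real" where
  "inner_bergman f g = Re (cinner f g)"

definition norm_bergman :: "bergman \<Rightarrow> real" where
  "norm_bergman f = sqrt (LINT z|disc_area. (cmod (bergman_apply f z))\<^sup>2)"

definition sgn_bergman :: "bergman \<Rightarrow> bergman" where
  "sgn_bergman f = inverse (norm f) *\<^sub>R f"

definition dist_bergman :: "bergman \<Rightarrow> bergman \<Rightarrow> real" where
  "dist_bergman f g = norm (f - g)"

definition uniformity_bergman :: "(bergman \<times> bergman) filter" where
  "uniformity_bergman = (INF e\<in>{0<..}. principal {(x, y). dist x y < e})"

definition open_bergman :: "bergman set \<Rightarrow> bool" where
  "open_bergman U = (\<forall>x\<in>U. eventually (\<lambda>(x', y). x' = x \<longrightarrow> y \<in> U) uniformity)"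

instance
proof
  fix f g h :: bergman and a b :: real
  note apply_in = bergman_apply
  show "a *\<^sub>R (f + g) = a *\<^sub>R f + a *\<^sub>R g" "(a + b) *\<^sub>R f = a *\<^sub>R f + b *\<^sub>R f"
    "a *\<^sub>R b *\<^sub>R f = (a * b) *\<^sub>R f" "1 *\<^sub>R f = f"
    unfolding scaleR_bergman_def by (transfer; simp add: fun_eq_iff algebra_simps)+
  have cinner_self: "cinner f f = of_real (LINT z|disc_area. (cmod (bergman_apply f z))\<^sup>2)" for f
    unfolding cinner.rep_eq complex_norm_square[symmetric] by (rule integral_complex_of_real)
  have cinner_cnj: "cinner f g = cnj (cinner g f)" for f g
    unfolding cinner.rep_eq
    by (simp add: mult.commute flip: Bochner_Integration.integral_cnj)
  show "inner f g = inner g f"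
    unfolding inner_bergman_def by (subst cinner_cnj) simp
  show "inner (f + g) h = inner f h + inner g h"
    unfolding inner_bergman_def cinner.rep_eq plus_bergman.rep_eq
    by (simp add: distrib_right Bochner_Integration.integral_add
          bergman_carrier_integrable_mult[OF apply_in apply_in])
  show "inner (a *\<^sub>R f) g = a * inner f g"
    unfolding inner_bergman_def scaleR_bergman_def cinner.rep_eq scaleC.rep_eq
    by (simp add: mult.assoc)
  show "0 \<le> inner f f" "norm f = sqrt (inner f f)"
    unfolding inner_bergman_def cinner_self norm_bergman_def by simp_all
  show "inner f f = 0 \<longleftrightarrow> f = 0"
  proof
    assume "inner f f = 0"
    then have "bergman_apply f z = 0" for z
      unfolding inner_bergman_def cinner_self
      using bergman_carrier_eq_0[OF apply_in, of f z] by simp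
    then show "f = 0" by (transfer, auto)
  qed (simp add: inner_bergman_def cinner_self zero_bergman.rep_eq)
qed (simp_all add: sgn_bergman_def dist_bergman_def uniformity_bergman_def open_bergman_def)

end

definition bounded_clinear :: "(bergman \<Rightarrow> bergman) \<Rightarrow> bool" where
  "bounded_clinear L \<longleftrightarrow> bounded_linear L \<and> (\<forall>c f. L (c *\<^sub>C f) = c *\<^sub>C L f)"

text \<open>
  For bounded complex-linear operators the description is proper: uniqueness is definiteness of the
  inner product, existence is the Riesz representation theorem (the space is complete).
\<close>

definition hilbert_adjoint :: "(bergman \<Rightarrow> bergman) \<Rightarrow> bergman \<Rightarrow> bergman" where
  "hilbert_adjoint L = (THE M. \<forall>f g. cinner (L f) g = cinner f (M g))"

text \<open>
  Outside the disc the parameter is meaningless; the kernel is then set to zero.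
\<close>

lift_definition normalized_kernel :: "complex \<Rightarrow> bergman" is
  "\<lambda>w z. if w \<in> ball 0 1 \<and> z \<in> ball 0 1
     then of_real (1 - (cmod w)\<^sup>2) / (1 - cnj w * z)\<^sup>2 else 0"
proof -
  fix w :: complex
  define k where "k = (\<lambda>z. if w \<in> ball 0 1 \<and> z \<in> ball 0 1
     then of_real (1 - (cmod w)\<^sup>2) / (1 - cnj w * z)\<^sup>2 else 0)"
  show "k \<in> bergman_carrier"
  proof (cases "w \<in> ball 0 1")
    case False
    then have "k = (\<lambda>_. 0)" by (auto simp: k_def)
    then show ?thesis by (simp only: bergman_carrier_zero)
  next
    case True
    then have w: "cmod w < 1" by simp
    have lower: "1 - cmod w \<le> cmod (1 - cnj w * z)" if "cmod z < 1" for z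
    proof -
      have "cmod w * cmod z \<le> cmod w"
        using that mult_left_mono[of "cmod z" 1 "cmod w"] by simp
      moreover have "1 - cmod (cnj w * z) \<le> cmod (1 - cnj w * z)"
        using norm_triangle_ineq2[of 1 "cnj w * z"] by simp
      ultimately show ?thesis by (simp add: norm_mult)
    qed
    have nz: "1 - cnj w * z \<noteq> 0" if "cmod z < 1" for z
      using lower[OF that] w by auto
    have "(\<lambda>z. of_real (1 - (cmod w)\<^sup>2) / (1 - cnj w * z)\<^sup>2) holomorphic_on ball 0 1"
      using nz by (intro holomorphic_intros) auto
    moreover have k_eq: "k z = of_real (1 - (cmod w)\<^sup>2) / (1 - cnj w * z)\<^sup>2" if "z \<in> ball 0 1" for z
      using that True by (simp add: k_def)
    ultimately have hol: "k holomorphic_on ball 0 1"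
      by (subst holomorphic_cong[OF refl k_eq]) auto
    have "(\<lambda>z. if z \<in> ball 0 1 then k z else 0) \<in> borel_measurable borel"
      using hol by (intro borel_measurable_continuous_on_if)
        (auto intro!: holomorphic_on_imp_continuous_on)
    also have "(\<lambda>z. if z \<in> ball 0 1 then k z else 0) = k"
      by (auto simp: k_def)
    finally have [measurable]: "k \<in> borel_measurable borel" .
    define C where "C = 1 / (1 - cmod w)\<^sup>2"
    have "cmod (k z) \<le> C" for z
    proof (cases "z \<in> ball 0 1")
      case True
      have "\<bar>1 - (cmod w)\<^sup>2\<bar> \<le> 1"
        using w by (simp add: abs_le_iff power_le_one)
      moreover have "(1 - cmod w)\<^sup>2 \<le> (cmod (1 - cnj w * z))\<^sup>2"
        using lower[of z] w True by (intro power_mono) auto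
      ultimately show ?thesis
        using w unfolding k_eq[OF True] C_def norm_divide norm_power norm_of_real
        by (intro frac_le) auto
    qed (simp add: k_def C_def)
    then have "AE z in disc_area. norm ((cmod (k z))\<^sup>2) \<le> C\<^sup>2"
      by (intro AE_I2) (auto intro!: power_mono)
    then have "integrable disc_area (\<lambda>z. (cmod (k z))\<^sup>2)"
      by (intro disc_area.integrable_const_bound) auto
    with hol show ?thesis by (auto simp: bergman_carrier_def k_def)
  qed
qed

definition ell2 :: "(nat \<Rightarrow> complex) \<Rightarrow> bool" where
  "ell2 c \<longleftrightarrow> summable (\<lambda>n. (cmod (c n))\<^sup>2)"

definition ell2_norm :: "(nat \<Rightarrow> complex) \<Rightarrow> real" where
  "ell2_norm c = sqrt (\<Sum>n. (cmod (c n))\<^sup>2)"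

definition bessel_sequence :: "(nat \<Rightarrow> bergman) \<Rightarrow> bool" where
  "bessel_sequence g \<longleftrightarrow> (\<exists>B>0. \<forall>f.
     summable (\<lambda>n. (cmod (cinner f (g n)))\<^sup>2) \<and>
     (\<Sum>n. (cmod (cinner f (g n)))\<^sup>2) \<le> B * (norm f)\<^sup>2)"

definition atomic_system :: "(nat \<Rightarrow> bergman) \<Rightarrow> (bergman \<Rightarrow> bergman) \<Rightarrow> bool" where
  "atomic_system g L \<longleftrightarrow>
     (\<forall>c. ell2 c \<longrightarrow> summable (\<lambda>n. c n *\<^sub>C g n)) \<and>
     (\<exists>C>0. \<forall>f. \<exists>a. ell2 a \<and> ell2_norm a \<le> C * norm f \<and> (\<lambda>n. a n *\<^sub>C g n) sums L f)"

definition sampling_sequence :: "(nat \<Rightarrow> complex) \<Rightarrow> (bergman \<Rightarrow> bergman) \<Rightarrow> bool" where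
  "sampling_sequence l L \<longleftrightarrow> (\<exists>A>0. \<exists>B>0. \<forall>f.
     summable (\<lambda>n. (cmod (bergman_apply f (l n)))\<^sup>2 * (1 - (cmod (l n))\<^sup>2)\<^sup>2) \<and>
     A * (norm (hilbert_adjoint L f))\<^sup>2
       \<le> (\<Sum>n. (cmod (bergman_apply f (l n)))\<^sup>2 * (1 - (cmod (l n))\<^sup>2)\<^sup>2) \<and>
     (\<Sum>n. (cmod (bergman_apply f (l n)))\<^sup>2 * (1 - (cmod (l n))\<^sup>2)\<^sup>2) \<le> B * (norm f)\<^sup>2)"

end

theory Submission
  imports Defs "HOL-Complex_Analysis.Cauchy_Integral_Formula" "HOL-Real_Asymp.Real_Asymp"
begin

text \<open>
  Write \<open>e\<^sub>n\<close> for the normalized kernel at \<open>\<lambda>\<^sub>n\<close>. The reproducing property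
  \<open>\<langle>f, e\<^sub>n\<rangle> = (1 - |\<lambda>\<^sub>n|\<^sup>2) f(\<lambda>\<^sub>n)\<close> (\<open>cinner_normalized_kernel\<close>) turns every condition into a statement
  about the coefficients \<open>\<langle>f, e\<^sub>n\<rangle>\<close>, and such statements are equivalent for an arbitrary sequence
  \<open>e\<close> in a Hilbert space.

  The reproducing property comes from the orthogonality of the monomials on discs around 0: mixed
  moments vanish by rotation invariance of area, and radial moments are computed from the uniform
  distribution of \<open>|z|\<^sup>2\<close>. It also bounds point evaluations, which gives completeness of the space.

  In the Hilbert space, let \<open>\<Theta> f = (\<langle>f, e\<^sub>n\<rangle>)\<^sub>n\<close> be the analysis operator; formally its adjoint is the
  synthesis \<open>c \<mapsto> \<Sum> c\<^sub>n e\<^sub>n\<close>. By the uniform boundedness principle, \<open>e\<close> is a Bessel sequence as soon as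
  synthesis converges for all square-summable coefficients
  (\<open>bessel_sequence_if_synthesis_converges\<close>), or as soon as \<open>\<Theta> f\<close> is square-summable for all \<open>f\<close>
  (\<open>bessel_sequence_if_square_summable\<close>).

  An atomic system bounds \<open>\<parallel>L\<^sup>* f\<parallel>\<close> by a multiple of \<open>\<parallel>\<Theta> f\<parallel>\<close>, as one sees by expanding \<open>L (L\<^sup>* f)\<close>; this
  is the lower sampling inequality. Conversely, that inequality says that \<open>L\<^sup>*\<close> factors through
  \<open>\<Theta>\<close>. A Riesz theorem on the range of \<open>\<Theta>\<close> produces for each \<open>f\<close> a coefficient sequence of \<open>L f\<close> that
  depends linearly on \<open>f\<close>, and its entries are \<open>\<langle>f, g\<^sub>n\<rangle>\<close> for a Bessel sequence \<open>g\<close>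
  (\<open>dual_bessel_sequence\<close>). Such an expansion of \<open>L\<close> clearly makes \<open>e\<close> an atomic system for \<open>L\<close>, and
  taking adjoints exchanges \<open>L = \<Sum> \<langle>\<cdot>, g\<^sub>n\<rangle> e\<^sub>n\<close> with \<open>L\<^sup>* = \<Sum> \<langle>\<cdot>, e\<^sub>n\<rangle> g\<^sub>n\<close>
  (\<open>expansion_adjoint\<close>).
\<close>

section \<open>Moments of area measure on discs\<close>

definition plane_vec :: "complex \<Rightarrow> real^2" where
  "plane_vec z = vector [Re z, Im z]"

definition vec_plane :: "real^2 \<Rightarrow> complex" where
  "vec_plane v = Complex (v $ 1) (v $ 2)"

lemma vec_plane_inverse [simp]: "plane_vec (vec_plane v) = v" "vec_plane (plane_vec z) = z"
  by (auto simp: plane_vec_def vec_plane_def vec_eq_iff forall_2 complex_eq_iff)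

lemma linear_vec_plane: "linear plane_vec" "linear vec_plane"
  by (auto simp: plane_vec_def vec_plane_def linear_iff vec_eq_iff forall_2 complex_eq_iff)

lemma measurable_vec_plane [measurable]:
  "plane_vec \<in> borel \<rightarrow>\<^sub>M borel" "vec_plane \<in> borel \<rightarrow>\<^sub>M borel"
  using linear_vec_plane
  by (auto intro!: borel_measurable_continuous_onI linear_continuous_on
      simp: linear_conv_bounded_linear)

lemma norm_plane_vec: "norm (plane_vec z) = cmod z"
  by (simp add: plane_vec_def norm_vec_def L2_set_def sum_2 cmod_def)

lemma norm_vec_plane: "cmod (vec_plane v) = norm v"
  by (metis norm_plane_vec vec_plane_inverse(1))

lemma Basis_plane: "(Basis :: (real^2) set) = {axis 1 1, axis 2 1}"
  by (auto simp: Basis_vec_def) (metis exhaust_2)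

text \<open>
  The preimage of a box is a box with the same sides. Facts about the measure of linear images of
  vector sets are thereby available in the complex plane.
\<close>

lemma distr_vec_plane: "distr lborel borel vec_plane = lborel"
proof (rule lborel_eqI[symmetric])
  fix l u :: complex
  assume le: "\<And>b. b \<in> Basis \<Longrightarrow> l \<bullet> b \<le> u \<bullet> b"
  have le2: "\<And>b. b \<in> Basis \<Longrightarrow> plane_vec l \<bullet> b \<le> plane_vec u \<bullet> b"
    using le[of 1] le[of \<i>]
    by (auto simp: Basis_plane inner_axis plane_vec_def Basis_complex_def)
  have vim: "vec_plane -` box l u = box (plane_vec l) (plane_vec u)"
    by (auto simp: vec_plane_def box_def Basis_plane Basis_complex_def inner_axis plane_vec_def)
  have "emeasure (distr lborel borel vec_plane) (box l u)
      = (\<Prod>b\<in>Basis. (plane_vec u - plane_vec l) \<bullet> b)"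
    using le2 by (simp add: emeasure_distr vim emeasure_lborel_box)
  also have "(\<Prod>b\<in>Basis. (plane_vec u - plane_vec l) \<bullet> b)
      = (\<Prod>b\<in>(Basis::complex set). (u - l) \<bullet> b)"
  proof -
    have "axis 1 1 \<noteq> (axis 2 1 :: real^2)" by (simp add: axis_eq_axis)
    then show ?thesis
      by (simp add: Basis_plane Basis_complex_def inner_axis plane_vec_def)
  qed
  finally show "emeasure (distr lborel borel vec_plane) (box l u)
      = (\<Prod>b\<in>Basis. (u - l) \<bullet> b)" .
qed simp

text \<open>
  Multiplication by a unimodular number is orthogonal on the plane, so it preserves the measure of
  every box, and a measure on Borel sets that agrees with Lebesgue measure on boxes is Lebesgue
  measure.
\<close>

lemma distr_lborel_rotate:
  assumes "cmod w = 1"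
  shows "distr lborel borel (\<lambda>z. w * z) = lborel"
proof (rule lborel_eqI[symmetric])
  fix l u :: complex
  assume le: "\<And>b. b \<in> Basis \<Longrightarrow> l \<bullet> b \<le> u \<bullet> b"
  define R where "R v = plane_vec (cnj w * vec_plane v)" for v
  have wc: "w * cnj w = 1" using assms by (simp add: complex_norm_square[symmetric])
  then have cw: "cnj w * w = 1" by (simp add: mult.commute)
  have "linear R"
  proof -
    have "linear (\<lambda>v. cnj w * v)" by (auto simp: linear_iff algebra_simps)
    from linear_compose[OF linear_compose[OF linear_vec_plane(2) this] linear_vec_plane(1)]
    show ?thesis by (simp add: o_def R_def[abs_def])
  qed
  then have orth: "orthogonal_transformation R"
    using assms by (auto simp: orthogonal_transformation R_def norm_plane_vec norm_mult norm_vec_plane)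
  define S where "S = vec_plane -` box l u"
  have eq: "vec_plane -` ((*) w -` box l u) = R ` S"
  proof (intro equalityI subsetI)
    fix v assume "v \<in> vec_plane -` ((*) w -` box l u)"
    then have "plane_vec (w * vec_plane v) \<in> S" by (auto simp: S_def)
    moreover have "R (plane_vec (w * vec_plane v)) = v"
      by (simp add: R_def mult.assoc[symmetric] cw)
    ultimately show "v \<in> R ` S" by (metis image_eqI)
  next
    fix v assume "v \<in> R ` S"
    then show "v \<in> vec_plane -` ((*) w -` box l u)"
      by (auto simp: R_def S_def mult.assoc[symmetric] wc)
  qed
  have Sb: "S \<in> sets borel"
    using measurable_sets[OF measurable_vec_plane(2), of "box l u"] by (simp add: S_def)
  have bd: "emeasure lborel S = emeasure lborel (box l u)"
    by (subst distr_vec_plane[symmetric]) (simp add: emeasure_distr S_def)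
  have Sm: "S \<in> lmeasurable"
    using Sb bd emeasure_lborel_box_finite[of l u] by (auto simp: fmeasurable_def less_top)
  have m: "(*) w \<in> borel_measurable borel" by measurable
  have m': "(*) w -` box l u \<in> sets borel"
    using measurable_sets[OF m, of "box l u"] by simp
  have RSb: "R ` S \<in> sets borel"
    using measurable_sets[OF measurable_vec_plane(2) m'] by (simp add: eq)
  have "emeasure (distr lborel borel ((*) w)) (box l u) = emeasure lborel ((*) w -` box l u)"
    by (simp add: emeasure_distr)
  also have "\<dots> = emeasure lborel (R ` S)"
    using m' by (subst distr_vec_plane[symmetric]) (simp add: emeasure_distr eq)
  also have "\<dots> = emeasure lebesgue (R ` S)" using RSb by simp
  also have "\<dots> = emeasure lebesgue S"
    using measurable_orthogonal_image[OF orth Sm] measure_orthogonal_image[OF orth Sm] Sm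
    by (simp add: emeasure_eq_measure2)
  also have "\<dots> = emeasure lborel (box l u)" using Sb bd by simp
  also have "\<dots> = (\<Prod>b\<in>Basis. (u - l) \<bullet> b)" using le by (simp add: emeasure_lborel_box)
  finally show "emeasure (distr lborel borel ((*) w)) (box l u) = (\<Prod>b\<in>Basis. (u - l) \<bullet> b)" .
qed simp

text \<open>
  The annulus \<open>{z. x < |z|\<^sup>2 < r\<^sup>2}\<close> has area \<open>\<pi> (r\<^sup>2 - x)\<close> for
  \<open>0 \<le> x \<le> r\<^sup>2\<close>, which is linear in \<open>x\<close>; so under area
  measure on a disc the variable \<open>|z|\<^sup>2\<close> is uniformly distributed. This replaces polar coordinates in
  the computation of radial integrals.
\<close>

lemma distr_square_modulus:
  assumes "r > 0"
  shows "distr (density lborel (indicator (ball 0 r))) borel (\<lambda>z::complex. (cmod z)\<^sup>2)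
       = density lborel (\<lambda>t. ennreal pi * indicator {0..r\<^sup>2} t)" (is "?M = ?N")
proof (rule measure_eqI_lessThan)
  have ball_c: "emeasure lborel (ball (0::complex) s) = ennreal (pi * s\<^sup>2)"
    "emeasure lborel (cball (0::complex) s) = ennreal (pi * s\<^sup>2)" if "s \<ge> 0" for s
    using that by (simp_all add: emeasure_ball emeasure_cball unit_ball_vol_2 )
  fix x :: real
  have [measurable]: "(indicator (ball (0::complex) r) :: complex \<Rightarrow> ennreal) \<in> borel_measurable borel"
    by (intro borel_measurable_indicator) auto
  have M: "emeasure ?M {x<..} = emeasure lborel (ball 0 r \<inter> {z::complex. x < (cmod z)\<^sup>2})"
  proof -
    have "emeasure ?M {x<..} =
      emeasure (density lborel (indicator (ball 0 r))) {z::complex. x < (cmod z)\<^sup>2}"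
      by (subst emeasure_distr) (auto simp: vimage_def)
    also have "\<dots> = (\<integral>\<^sup>+z. indicator (ball 0 r) z * indicator {z::complex. x < (cmod z)\<^sup>2} z \<partial>lborel)"
      by (subst emeasure_density) auto
    also have "\<dots> = (\<integral>\<^sup>+z. indicator (ball 0 r \<inter> {z::complex. x < (cmod z)\<^sup>2}) z \<partial>lborel)"
      by (intro nn_integral_cong) (auto simp: indicator_def)
    finally show ?thesis by simp
  qed
  have N: "emeasure ?N {x<..} = ennreal pi * emeasure lborel ({0..r\<^sup>2} \<inter> {x<..})"
  proof -
    have "emeasure ?N {x<..} = (\<integral>\<^sup>+t. ennreal pi * indicator {0..r\<^sup>2} t * indicator {x<..} t \<partial>lborel)"
      by (subst emeasure_density) auto
    also have "\<dots> = (\<integral>\<^sup>+t. ennreal pi * indicator ({0..r\<^sup>2} \<inter> {x<..}) t \<partial>lborel)"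
      by (intro nn_integral_cong) (auto simp: indicator_def)
    finally show ?thesis by (simp add: nn_integral_cmult_indicator)
  qed
  have "emeasure lborel (ball 0 r \<inter> {z::complex. x < (cmod z)\<^sup>2}) \<le> emeasure lborel (ball (0::complex) r)"
    by (intro emeasure_mono) auto
  also have "\<dots> < \<infinity>" by (rule emeasure_lborel_ball_finite)
  finally show "emeasure ?M {x<..} < \<infinity>" unfolding M .
  consider "x < 0" | "0 \<le> x" "x \<le> r\<^sup>2" | "r\<^sup>2 < x" by linarith
  then show "emeasure ?M {x<..} = emeasure ?N {x<..}"
  proof cases
    case 1
    have "ball 0 r \<inter> {z::complex. x < (cmod z)\<^sup>2} = ball 0 r"
      using 1 by (auto intro: less_le_trans)
    moreover have "{0..r\<^sup>2} \<inter> {x<..} = {0..r\<^sup>2}" using 1 by auto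
    ultimately show ?thesis unfolding M N using assms by (simp add: ball_c ennreal_mult)
  next
    case 2
    define s where "s = sqrt x"
    have s: "0 \<le> s" "s\<^sup>2 = x" using 2 by (auto simp: s_def)
    have sr: "s \<le> r" using 2 assms by (simp add: s_def real_le_lsqrt)
    have lt: "x < y\<^sup>2 \<longleftrightarrow> s < y" if "y \<ge> 0" for y :: real
      using s that by (metis abs_of_nonneg abs_square_less_1 power2_less_imp_less power_strict_mono zero_less_numeral)
    have "ball 0 r \<inter> {z::complex. x < (cmod z)\<^sup>2} = ball 0 r - cball 0 s"
      by (auto simp: lt)
    moreover have "emeasure lborel (ball 0 r - cball (0::complex) s) = ennreal (pi * r\<^sup>2 - pi * s\<^sup>2)"
    proof (cases "s = r")
      case True
      then have "ball 0 r - cball (0::complex) s = {}" by auto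
      then show ?thesis unfolding True by (simp only: emeasure_empty) simp
    next
      case False
      then have "cball (0::complex) s \<subseteq> ball 0 r" using sr by auto
      then show ?thesis using s assms
        by (subst emeasure_Diff) (auto simp: ball_c ennreal_minus)
    qed
    moreover have "{0..r\<^sup>2} \<inter> {x<..} = {x<..r\<^sup>2}" using 2 by auto
    ultimately show ?thesis unfolding M N using 2 s
      by (simp add: ennreal_mult[symmetric] algebra_simps)
  next
    case 3
    have "ball 0 r \<inter> {z::complex. x < (cmod z)\<^sup>2} = {}"
    proof -
      have "(cmod z)\<^sup>2 \<le> r\<^sup>2" if "cmod z < r" for z using that by (intro power_mono) auto
      then show ?thesis using 3 by fastforce
    qed
    moreover have "{0..r\<^sup>2} \<inter> {x<..} = {}" using 3 by auto
    ultimately show ?thesis unfolding M N by simp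
  qed
qed auto

lemma ball_radial_moment:
  assumes "r > 0"
  shows "(LINT z:ball 0 r|lborel. (cmod z) ^ (2*n)) = pi * r ^ (2*n+2) / (n+1)"
proof -
  have [measurable]: "(indicator (ball (0::complex) r) :: complex \<Rightarrow> ennreal) \<in> borel_measurable borel"
    "(indicator (ball (0::complex) r) :: complex \<Rightarrow> real) \<in> borel_measurable borel"
    by (auto intro!: borel_measurable_indicator)
  have "(LINT z:ball 0 r|lborel. (cmod z) ^ (2*n))
     = (LINT z|density lborel (\<lambda>z::complex. ennreal (indicator (ball 0 r) z)). ((cmod z)\<^sup>2) ^ n)"
    unfolding set_lebesgue_integral_def
    by (subst integral_density) (auto simp: power_mult)
  also have "\<dots> = (LINT t|distr (density lborel (indicator (ball 0 r))) borel (\<lambda>z::complex. (cmod z)\<^sup>2). t ^ n)"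
    by (subst integral_distr) (auto simp: ennreal_indicator)
  also have "\<dots> = (LINT t|density lborel (\<lambda>t. ennreal (pi * indicator {0..r\<^sup>2} t)). t ^ n)"
    unfolding distr_square_modulus[OF assms] by (simp add: ennreal_mult ennreal_indicator)
  also have "\<dots> = (LINT t|lborel. pi * (t ^ n * indicator {0..r\<^sup>2} t))"
    by (subst integral_density) (auto simp: mult_ac)
  also have "\<dots> = pi * (LINT t|lborel. t ^ n * indicator {0..r\<^sup>2} t)"
    by simp
  also have "(LINT t|lborel. t ^ n * indicator {0..r\<^sup>2} t) = r ^ (2*n+2) / (n+1)"
    using integral_power[of 0 "r\<^sup>2" n] power_mult[of r 2 "Suc n"] by (simp add: add.commute)
  finally show ?thesis by simp
qed

text \<open>
  The rotation by \<open>\<pi> / (m - n)\<close> preserves area and the disc but changes the sign of the integrand.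
\<close>

lemma ball_mixed_moment:
  assumes "m \<noteq> n"
  shows "(LINT z:ball 0 r|lborel. z ^ m * cnj z ^ n) = 0"
proof -
  define t where "t = pi / (real m - real n)"
  define w where "w = cis t"
  have w: "cmod w = 1" by (simp add: w_def)
  have "w ^ m * cnj w ^ n = cis ((real m - real n) * t)"
    by (simp add: w_def Complex.DeMoivre cis_cnj cis_mult left_diff_distrib)

  also have "(real m - real n) * t = pi" using assms by (simp add: t_def)
  finally have wmn: "w ^ m * cnj w ^ n = -1" by simp
  define I where "I = (LINT z:ball 0 r|lborel. z ^ m * cnj z ^ n)"
  have [measurable]: "(\<lambda>z. cnj z) \<in> borel_measurable borel"
    by (intro borel_measurable_continuous_onI continuous_intros)
  have [measurable]: "(indicator (ball (0::complex) r) :: complex \<Rightarrow> real) \<in> borel_measurable borel"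
    by (auto intro!: borel_measurable_indicator)
  have "I = (LINT z|distr lborel borel (\<lambda>z. w * z). indicator (ball 0 r) z *\<^sub>R (z ^ m * cnj z ^ n))"
    by (simp add: distr_lborel_rotate[OF w] I_def set_lebesgue_integral_def)
  also have "\<dots> = (LINT z|lborel. indicator (ball 0 r) (w * z) *\<^sub>R ((w * z) ^ m * cnj (w * z) ^ n))"
    by (subst integral_distr) auto
  also have "\<dots> = (LINT z|lborel. (w ^ m * cnj w ^ n) * (indicator (ball 0 r) z *\<^sub>R (z ^ m * cnj z ^ n)))"
    by (intro Bochner_Integration.integral_cong)
       (auto simp: indicator_def norm_mult w power_mult_distrib)
  also have "\<dots> = - I"
    by (simp add: wmn I_def set_lebesgue_integral_def)
  finally show ?thesis by (simp add: I_def)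
qed

lemma ball_moment:
  assumes "r > 0"
  shows "(LINT z:ball 0 r|lborel. z ^ m * cnj z ^ n)
    = (if m = n then of_real (pi * r ^ (2*n+2) / (n+1)) else 0)"
proof (cases "m = n")
  case True
  have "z ^ n * cnj z ^ n = of_real (cmod z ^ (2*n))" for z
    by (simp add: power_mult_distrib[symmetric] complex_norm_square[symmetric] power_mult)
  then show ?thesis
    using True ball_radial_moment[OF assms, of n]
    by (simp only: set_integral_complex_of_real if_True refl)
qed (simp add: ball_mixed_moment)

section \<open>The reproducing property of the Bergman kernel\<close>

text \<open>
  On a disc strictly inside the disc of convergence the series is dominated by a convergent numerical
  series, so it may be integrated term by term against a bounded function.
\<close>

lemma ball_integral_power_series:
  fixes a :: "nat \<Rightarrow> complex" and g :: "complex \<Rightarrow> complex"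
  assumes r: "0 < r" and a: "summable (\<lambda>m. cmod (a m) * r ^ m)"
    and [measurable]: "g \<in> borel_measurable borel"
    and B: "\<And>z. cmod z < r \<Longrightarrow> cmod (g z) \<le> B"
  shows "(\<lambda>m. a m * (LINT z:ball 0 r|lborel. z ^ m * g z)) sums
    (LINT z:ball 0 r|lborel. (\<Sum>m. a m * z ^ m) * g z)"
proof -
  define F where "F m z = indicator (ball 0 r) z *\<^sub>R (a m * z ^ m * g z)" for m z
  have [measurable]: "(indicator (ball (0::complex) r) :: complex \<Rightarrow> real) \<in> borel_measurable borel"
    by (auto intro!: borel_measurable_indicator)
  have [measurable]: "F m \<in> borel_measurable lborel" for m
    unfolding F_def by measurable
  have B0: "B \<ge> 0" using order_trans[OF norm_ge_zero B[of 0]] r by simp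
  have bound: "norm (F m z) \<le> cmod (a m) * r ^ m * B * indicator (ball 0 r) z" for m z
  proof (cases "cmod z < r")
    case True
    have "cmod (a m) * cmod z ^ m * cmod (g z) \<le> cmod (a m) * r ^ m * B"
      using True B[OF True] B0 r by (intro mult_mono mult_left_mono power_mono) auto
    then show ?thesis using True by (simp add: F_def norm_mult norm_power)
  qed (simp add: F_def)
  have ind: "integrable lborel (indicator (ball (0::complex) r) :: complex \<Rightarrow> real)"
    using emeasure_lborel_ball_finite[of "0::complex" r] by (intro integrable_real_indicator) auto
  have intb: "integrable lborel (\<lambda>z::complex. cmod (a m) * r ^ m * B * indicator (ball 0 r) z)" for m
    using ind by (intro integrable_mult_right) auto
  have intF: "integrable lborel (F m)" for m
    by (rule Bochner_Integration.integrable_bound[OF intb[of m]])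
       (use bound[of m] in \<open>auto intro!: AE_I2 order_trans[OF _ abs_ge_self]\<close>)
  have sumF: "summable (\<lambda>m. norm (F m z))" for z
  proof (rule summable_comparison_test'[where N=0])
    show "summable (\<lambda>m. cmod (a m) * r ^ m * (B * indicator (ball 0 r) z))"
      using a by (rule summable_mult2)
    show "norm (norm (F m z)) \<le> cmod (a m) * r ^ m * (B * indicator (ball 0 r) z)" for m
      using bound[of m z] by (simp add: mult.assoc)
  qed
  have "summable (\<lambda>m. LINT z|lborel. norm (F m z))"
  proof (rule summable_comparison_test'[where N=0])
    show "summable (\<lambda>m. cmod (a m) * r ^ m * (B * (LINT z::complex|lborel. indicator (ball 0 r) z)))"
      using a by (rule summable_mult2)
    show "norm (LINT z|lborel. norm (F m z))
       \<le> cmod (a m) * r ^ m * (B * (LINT z::complex|lborel. indicator (ball 0 r) z))" for m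
    proof -
      have "(LINT z|lborel. norm (F m z)) \<le> (LINT z::complex|lborel. cmod (a m) * r ^ m * B * indicator (ball 0 r) z)"
        by (intro integral_mono intb integrable_norm intF bound)
      then show ?thesis by (simp add: mult.assoc)
    qed
  qed
  then have "(\<lambda>m. integral\<^sup>L lborel (F m)) sums (LINT z|lborel. (\<Sum>m. F m z))"
    by (intro sums_integral intF AE_I2 sumF)
  also have "(\<lambda>m. integral\<^sup>L lborel (F m)) = (\<lambda>m. a m * (LINT z:ball 0 r|lborel. z ^ m * g z))"
  proof
    fix m
    have "integral\<^sup>L lborel (F m) = (LINT z|lborel. a m * (indicator (ball 0 r) z *\<^sub>R (z ^ m * g z)))"
      by (intro Bochner_Integration.integral_cong) (auto simp: F_def)
    then show "integral\<^sup>L lborel (F m) = a m * (LINT z:ball 0 r|lborel. z ^ m * g z)"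
      by (simp only: set_lebesgue_integral_def integral_mult_right_zero)
  qed
  also have "(LINT z|lborel. (\<Sum>m. F m z)) = (LINT z:ball 0 r|lborel. (\<Sum>m. a m * z ^ m) * g z)"
    unfolding set_lebesgue_integral_def
  proof (intro Bochner_Integration.integral_cong refl)
    fix z
    show "(\<Sum>m. F m z) = indicator (ball 0 r) z *\<^sub>R ((\<Sum>m. a m * z ^ m) * g z)"
    proof (cases "cmod z < r")
      case True
      have "summable (\<lambda>m. cmod (a m * z ^ m))"
        by (rule summable_comparison_test'[OF a, where N=0])
           (use True in \<open>auto simp: norm_mult norm_power intro!: mult_left_mono power_mono\<close>)
      then have "summable (\<lambda>m. a m * z ^ m)" by (rule summable_norm_cancel)
      then show ?thesis using True by (simp add: F_def suminf_mult2)
    qed (simp add: F_def)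
  qed
  finally show ?thesis .
qed

text \<open>
  The Taylor series at 0 converges at some point between \<open>r\<close> and the unit circle, hence absolutely at
  modulus \<open>r\<close>.
\<close>

lemma holomorphic_disc_abs_summable:
  assumes "f holomorphic_on ball 0 1" "0 < r" "r < 1"
  shows "summable (\<lambda>m. cmod ((deriv ^^ m) f 0 / fact m) * r ^ m)"
proof -
  define s where "s = (1 + r) / 2"
  have s: "r < s" "s < 1" "0 < s" using assms by (auto simp: s_def)
  have "(\<lambda>m. (deriv ^^ m) f 0 / fact m * (of_real s - 0) ^ m) sums f (of_real s)"
    using s by (intro holomorphic_power_series[OF assms(1)]) auto
  then have "summable (\<lambda>m. (deriv ^^ m) f 0 / fact m * of_real s ^ m)"
    by (auto dest: sums_summable)
  from powser_insidea[OF this, of "of_real r"] s assms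
  show ?thesis by (simp add: norm_mult norm_power norm_divide)
qed

lemma disc_area_integral:
  fixes h :: "complex \<Rightarrow> complex"
  assumes [measurable]: "h \<in> borel_measurable borel"
  shows "(LINT z|disc_area. h z) = (LINT z:ball 0 1|lborel. h z) / pi"
proof -
  have [measurable]: "(indicator (ball (0::complex) 1) :: complex \<Rightarrow> real) \<in> borel_measurable borel"
    by (auto intro!: borel_measurable_indicator)
  have "(LINT z|disc_area. h z) = (LINT z|lborel. (indicator (ball 0 1) z / pi) *\<^sub>R h z)"
    unfolding disc_area_def by (subst integral_density) auto
  also have "\<dots> = (LINT z|lborel. (indicator (ball 0 1) z *\<^sub>R h z) / of_real pi)"
    by (intro Bochner_Integration.integral_cong) (auto simp: scaleR_conv_of_real)
  finally show ?thesis by (simp add: set_lebesgue_integral_def)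
qed

lemma disc_area_integrable:
  fixes h :: "complex \<Rightarrow> complex"
  assumes "integrable disc_area h"
  shows "set_integrable lborel (ball 0 1) h"
proof -
  have [measurable]: "h \<in> borel_measurable borel"
    using borel_measurable_integrable[OF assms] by simp
  have [measurable]: "(indicator (ball (0::complex) 1) :: complex \<Rightarrow> real) \<in> borel_measurable borel"
    by (auto intro!: borel_measurable_indicator)
  have "integrable lborel (\<lambda>z. (indicator (ball 0 1) z / pi) *\<^sub>R h z)"
    using assms unfolding disc_area_def by (subst (asm) integrable_density) auto
  then have "integrable lborel (\<lambda>z. pi *\<^sub>R ((indicator (ball 0 1) z / pi) *\<^sub>R h z))"
    by (rule integrable_scaleR_right)
  then show ?thesis by (simp add: set_integrable_def)
qed

text \<open>
  The reproducing formula on a smaller disc. By orthogonality of the monomials, integrating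
  \<open>f\<close> against \<open>z\<^sup>n\<close> isolates the Taylor coefficient \<open>a\<^sub>n\<close> with the factor
  \<open>\<pi> r\<^bsup>2n+2\<^esup> / (n + 1)\<close>; the coefficient \<open>n + 1\<close> in the expansion of the kernel cancels the
  denominator and leaves the Taylor series of \<open>f\<close> at \<open>r\<^sup>2 w\<close>. For \<open>r < 1\<close> both
  series converge uniformly on the disc of radius \<open>r\<close>, and \<open>f\<close> is bounded there.
\<close>

lemma ball_integral_kernel:
  fixes f :: "complex \<Rightarrow> complex"
  assumes hol: "f holomorphic_on ball 0 1" and [measurable]: "f \<in> borel_measurable borel"
    and r: "0 < r" "r < 1" and w: "cmod w < 1"
  shows "(LINT z:ball 0 r|lborel. f z * cnj (1 / (1 - cnj w * z)\<^sup>2)) = pi * r\<^sup>2 * f (r\<^sup>2 * w)"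
proof -
  define a where "a m = (deriv ^^ m) f 0 / fact m" for m
  have a_sums: "(\<lambda>m. a m * z ^ m) sums f z" if "cmod z < 1" for z
    using holomorphic_power_series[OF hol, of z] that by (simp add: a_def)
  have [measurable]: "(\<lambda>z. cnj z) \<in> borel_measurable borel"
    by (intro borel_measurable_continuous_onI continuous_intros)
  have coeff: "(LINT z:ball 0 r|lborel. f z * cnj z ^ n) = a n * of_real (pi * r ^ (2*n+2) / (n+1))" for n
  proof -
    have "(\<lambda>m. a m * (LINT z:ball 0 r|lborel. z ^ m * cnj z ^ n)) sums
      (LINT z:ball 0 r|lborel. (\<Sum>m. a m * z ^ m) * cnj z ^ n)"
      using r holomorphic_disc_abs_summable[OF hol r]
      by (intro ball_integral_power_series[where B=1]) (auto simp: a_def norm_power intro!: power_le_one)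
    also have "(LINT z:ball 0 r|lborel. (\<Sum>m. a m * z ^ m) * cnj z ^ n)
      = (LINT z:ball 0 r|lborel. f z * cnj z ^ n)"
      using r sums_unique[OF a_sums] by (intro set_lebesgue_integral_cong) auto
    also have "(\<lambda>m. a m * (LINT z:ball 0 r|lborel. z ^ m * cnj z ^ n))
      = (\<lambda>m. if m = n then a m * of_real (pi * r ^ (2*m+2) / (m+1)) else 0)"
      using r by (auto simp: ball_moment)
    finally have "(\<lambda>m. if m = n then a m * of_real (pi * r ^ (2*m+2) / (m+1)) else 0) sums
       (LINT z:ball 0 r|lborel. f z * cnj z ^ n)" .
    then show ?thesis by (rule sums_unique2) (rule sums_single)
  qed
  have "continuous_on (cball 0 r) f"
    using hol r by (intro holomorphic_on_imp_continuous_on holomorphic_on_subset[OF hol]) auto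
  then have "compact (f ` cball 0 r)" by (intro compact_continuous_image) auto
  then obtain B where B: "\<And>z. cmod z \<le> r \<Longrightarrow> cmod (f z) \<le> B"
    by (force dest!: compact_imp_bounded simp: bounded_iff)
  define b where "b n = of_nat (Suc n) * cnj w ^ n" for n
  have small: "cmod (cnj w * z) < 1" if "cmod z < 1" for z
    using mult_strict_mono'[OF w that] by (simp add: norm_mult)
  have b_sums: "(\<lambda>n. b n * z ^ n) sums (1 / (1 - cnj w * z)\<^sup>2)" if "cmod z < 1" for z
    using geometric_deriv_sums[OF small[OF that]] by (simp add: b_def power_mult_distrib mult.assoc)
  have "summable (\<lambda>n. of_nat (Suc n) * (cmod w * r) ^ n)"
    using geometric_deriv_sums[of "cmod w * r"] small[of "of_real r"] r
    by (auto simp: norm_mult dest: sums_summable)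
  then have b_abs: "summable (\<lambda>n. cmod (b n) * r ^ n)"
    by (simp add: b_def norm_mult norm_power power_mult_distrib mult.assoc del: of_nat_Suc)
  have "(\<lambda>n. b n * (LINT z:ball 0 r|lborel. z ^ n * cnj (f z))) sums
      (LINT z:ball 0 r|lborel. (\<Sum>n. b n * z ^ n) * cnj (f z))"
    using r b_abs B by (intro ball_integral_power_series[where B=B]) auto
  also have "(LINT z:ball 0 r|lborel. (\<Sum>n. b n * z ^ n) * cnj (f z))
      = (LINT z:ball 0 r|lborel. cnj (f z * cnj (1 / (1 - cnj w * z)\<^sup>2)))"
    using r sums_unique[OF b_sums, symmetric]
    by (intro set_lebesgue_integral_cong) (auto simp: mult.commute)
  also have "\<dots> = cnj (LINT z:ball 0 r|lborel. f z * cnj (1 / (1 - cnj w * z)\<^sup>2))"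
    unfolding set_lebesgue_integral_def
    by (subst Bochner_Integration.integral_cnj[symmetric]) (simp add: complex_cnj_scaleR)
  also have "(\<lambda>n. b n * (LINT z:ball 0 r|lborel. z ^ n * cnj (f z)))
     = (\<lambda>n. cnj (pi * r\<^sup>2 * (a n * (r\<^sup>2 * w) ^ n)))"
  proof
    fix n
    have "(LINT z:ball 0 r|lborel. z ^ n * cnj (f z)) = cnj (LINT z:ball 0 r|lborel. f z * cnj z ^ n)"
      unfolding set_lebesgue_integral_def
      by (subst Bochner_Integration.integral_cnj[symmetric]) (simp add: mult.commute complex_cnj_scaleR)
    also have "\<dots> = cnj (a n) * of_real (pi * r ^ (2*n+2) / (n+1))"
      by (simp only: coeff complex_cnj_mult complex_cnj_complex_of_real)
    also have "b n * \<dots> = cnj (pi * r\<^sup>2 * (a n * (r\<^sup>2 * w) ^ n)) * (of_nat (Suc n) * of_real (1 / (n+1)))"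
      by (simp add: b_def power_mult_distrib power_add power_mult power2_eq_square mult_ac del: of_nat_Suc)
    also have "of_nat (Suc n) * complex_of_real (1 / (n+1)) = 1"
      by (simp add: field_simps del: of_nat_Suc)
    finally show "b n * (LINT z:ball 0 r|lborel. z ^ n * cnj (f z)) = cnj (pi * r\<^sup>2 * (a n * (r\<^sup>2 * w) ^ n))"
      by simp
  qed
  finally have "(\<lambda>n. pi * r\<^sup>2 * (a n * (r\<^sup>2 * w) ^ n)) sums
      (LINT z:ball 0 r|lborel. f z * cnj (1 / (1 - cnj w * z)\<^sup>2))"
    by (simp only: sums_cnj)
  moreover have "(\<lambda>n. pi * r\<^sup>2 * (a n * (r\<^sup>2 * w) ^ n)) sums (pi * r\<^sup>2 * f (r\<^sup>2 * w))"
  proof (intro sums_mult a_sums)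
    have "r\<^sup>2 < 1" using r by (simp add: power_less_one_iff)
    then show "cmod (r\<^sup>2 * w) < 1" using mult_strict_mono'[OF _ w, of "r\<^sup>2"] r
      by (simp add: norm_mult norm_power)
  qed
  ultimately show ?thesis unfolding of_real_power by (rule sums_unique2)
qed

text \<open>
  The product of two square-integrable functions is integrable, so dominated convergence allows the
  radius in the previous formula to tend to 1.
\<close>

lemma cinner_normalized_kernel:
  assumes w: "w \<in> ball 0 1"
  shows "cinner f (normalized_kernel w) = of_real (1 - (cmod w)\<^sup>2) * bergman_apply f w"
proof -
  define F where "F = bergman_apply f"
  have F: "F \<in> bergman_carrier" by (simp add: F_def bergman_apply)
  have hol: "F holomorphic_on ball 0 1" using F by (simp add: bergman_carrier_def)
  have [measurable]: "F \<in> borel_measurable borel" using bergman_carrier_borel[OF F] .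
  define k where "k = bergman_apply (normalized_kernel w)"
  have [measurable]: "k \<in> borel_measurable borel"
    unfolding k_def by (rule bergman_carrier_borel[OF bergman_apply])
  have [measurable]: "(\<lambda>z. cnj (k z)) \<in> borel_measurable borel"
    by (rule borel_measurable_continuous_on[OF _ \<open>k \<in> borel_measurable borel\<close>]) (intro continuous_intros)
  define h where "h z = F z * cnj (k z)" for z
  have [measurable]: "h \<in> borel_measurable borel" unfolding h_def by measurable
  define c where "c = of_real (1 - (cmod w)\<^sup>2) * (of_real pi :: complex)"
  have "integrable disc_area h"
    unfolding h_def F_def k_def by (intro bergman_carrier_integrable_mult bergman_apply)
  then have int: "set_integrable lborel (ball 0 1) h" by (rule disc_area_integrable)
  define r where "r j = 1 - 1 / (real j + 2)" for j
  have r: "0 < r j" "r j < 1" for j by (auto simp: r_def field_simps)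
  have r_lim: "r \<longlonglongrightarrow> 1" unfolding r_def by real_asymp
  have val: "(LINT z:ball 0 (r j)|lborel. h z) = c * (r j)\<^sup>2 * F ((r j)\<^sup>2 * w)" for j
  proof -
    have "(LINT z:ball 0 (r j)|lborel. h z)
       = (LINT z:ball 0 (r j)|lborel. of_real (1 - (cmod w)\<^sup>2) * (F z * cnj (1 / (1 - cnj w * z)\<^sup>2)))"
      using r[of j] w
      by (intro set_lebesgue_integral_cong) (auto simp: h_def k_def normalized_kernel.rep_eq)
    also have "\<dots> = of_real (1 - (cmod w)\<^sup>2) * (LINT z:ball 0 (r j)|lborel. F z * cnj (1 / (1 - cnj w * z)\<^sup>2))"
      by (rule set_integral_mult_right)
    also have "(LINT z:ball 0 (r j)|lborel. F z * cnj (1 / (1 - cnj w * z)\<^sup>2)) = pi * (r j)\<^sup>2 * F ((r j)\<^sup>2 * w)"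
      using ball_integral_kernel[OF hol _ r] w by simp
    finally show ?thesis by (simp add: c_def mult_ac)
  qed
  have "(\<lambda>j. LINT z:ball 0 (r j)|lborel. h z) \<longlonglongrightarrow> (LINT z:ball 0 1|lborel. h z)"
    unfolding set_lebesgue_integral_def
  proof (rule integral_dominated_convergence[where w="\<lambda>z. norm (indicator (ball 0 1) z *\<^sub>R h z)"])
    show "integrable lborel (\<lambda>z. norm (indicator (ball 0 1) z *\<^sub>R h z))"
      using int unfolding set_integrable_def by (rule integrable_norm)
    show "AE z in lborel. (\<lambda>j. indicator (ball 0 (r j)) z *\<^sub>R h z) \<longlonglongrightarrow> indicator (ball 0 1) z *\<^sub>R h z"
    proof (rule AE_I2)
      fix z
      show "(\<lambda>j. indicator (ball 0 (r j)) z *\<^sub>R h z) \<longlonglongrightarrow> indicator (ball 0 1) z *\<^sub>R h z"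
      proof (cases "cmod z < 1")
        case True
        then have "eventually (\<lambda>j. cmod z < r j) sequentially" using order_tendstoD(1)[OF r_lim] by auto
        then have "eventually (\<lambda>j. indicator (ball 0 (r j)) z *\<^sub>R h z = indicator (ball 0 1) z *\<^sub>R h z) sequentially"
          by eventually_elim (use True in \<open>simp\<close>)
        then show ?thesis by (rule tendsto_eventually)
      next
        case False
        then have "\<not> cmod z < r j" for j using r(2)[of j] by linarith
        then show ?thesis using False by simp
      qed
    qed
    show "AE z in lborel. norm (indicator (ball 0 (r j)) z *\<^sub>R h z) \<le> norm (indicator (ball 0 1) z *\<^sub>R h z)" for j
      using r(2)[of j] by (intro AE_I2) (auto simp: indicator_def)
  qed (auto intro!: borel_measurable_scaleR borel_measurable_indicator)
  moreover have "(\<lambda>j. LINT z:ball 0 (r j)|lborel. h z) \<longlonglongrightarrow> c * of_real (1\<^sup>2) * F w"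
    unfolding val
  proof (intro tendsto_mult tendsto_const tendsto_power tendsto_of_real r_lim)
    have "isCont F w"
      using hol w by (metis holomorphic_on_imp_continuous_on continuous_on_eq_continuous_at open_ball)
    moreover have "(\<lambda>j. of_real ((r j)\<^sup>2) * w) \<longlonglongrightarrow> of_real (1\<^sup>2) * w"
      by (intro tendsto_intros r_lim)
    ultimately show "(\<lambda>j. F (of_real ((r j)\<^sup>2) * w)) \<longlonglongrightarrow> F w"
      by (intro isCont_tendsto_compose[of w F]) auto
  qed
  ultimately have "(LINT z:ball 0 1|lborel. h z) = c * F w"
    by (metis LIMSEQ_unique mult.right_neutral of_real_1 power_one)
  moreover have "cinner f (normalized_kernel w) = (LINT z:ball 0 1|lborel. h z) / pi"
    by (simp add: cinner.rep_eq disc_area_integral[symmetric]) (simp add: h_def F_def k_def)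
  ultimately show ?thesis by (simp add: c_def F_def)
qed

section \<open>The complex Hilbert space structure of the Bergman space\<close>

lemma cinner_commute: "cinner f g = cnj (cinner g f)"
  unfolding cinner.rep_eq by (simp add: mult.commute flip: Bochner_Integration.integral_cnj)

lemma cinner_add_left: "cinner (f + g) h = cinner f h + cinner g h"
  unfolding cinner.rep_eq plus_bergman.rep_eq
  by (simp add: distrib_right Bochner_Integration.integral_add
      bergman_carrier_integrable_mult[OF bergman_apply bergman_apply])

lemma cinner_scaleC_left: "cinner (c *\<^sub>C f) g = c * cinner f g"
  unfolding cinner.rep_eq scaleC.rep_eq by (simp add: mult.assoc)

lemma cinner_scaleC_right: "cinner f (c *\<^sub>C g) = cnj c * cinner f g"
  by (subst (1 2) cinner_commute) (simp add: cinner_scaleC_left)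

lemma Re_cinner: "Re (cinner f g) = inner f g"
  by (simp add: inner_bergman_def)

lemma cinner_self: "cinner f f = of_real ((norm f)\<^sup>2)"
proof (rule complex_eqI)
  show "Im (cinner f f) = Im (of_real ((norm f)\<^sup>2))"
    using arg_cong[OF cinner_commute[of f f], of Im] by simp
qed (simp add: Re_cinner power2_norm_eq_inner)

lemma scaleC_scaleC: "a *\<^sub>C b *\<^sub>C f = (a * b) *\<^sub>C f"
  by (transfer) (simp add: mult.assoc)

lemma norm_scaleC: "norm (c *\<^sub>C f) = cmod c * norm f"
proof -
  have "complex_of_real ((norm (c *\<^sub>C f))\<^sup>2) = (c * cnj c) * cinner f f"
    by (simp only: cinner_self[symmetric] cinner_scaleC_left cinner_scaleC_right mult_ac)
  also have "\<dots> = of_real ((cmod c * norm f)\<^sup>2)"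
    by (simp only: cinner_self complex_norm_square[symmetric] power_mult_distrib of_real_mult)
  finally have "complex_of_real ((norm (c *\<^sub>C f))\<^sup>2) = of_real ((cmod c * norm f)\<^sup>2)" .
  then have "(norm (c *\<^sub>C f))\<^sup>2 = (cmod c * norm f)\<^sup>2"
    by (simp only: of_real_eq_iff)
  then show ?thesis by simp
qed

lemma cinner_Cauchy_Schwarz: "cmod (cinner f g) \<le> norm f * norm g"
proof (cases "cinner f g = 0")
  case False
  define c where "c = cinner f g"
  have "cinner (cnj c *\<^sub>C f) g = of_real ((cmod c)\<^sup>2)"
    by (simp only: cinner_scaleC_left c_def complex_norm_square mult.commute)
  then have "(cmod c)\<^sup>2 = inner (cnj c *\<^sub>C f) g"
    by (metis Re_cinner Re_complex_of_real)
  also have "\<dots> \<le> norm (cnj c *\<^sub>C f) * norm g" by (rule norm_cauchy_schwarz)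
  finally have "cmod c * cmod c \<le> cmod c * (norm f * norm g)"
    by (simp add: norm_scaleC power2_eq_square mult.assoc)
  then show ?thesis using False by (simp add: c_def)
qed simp

lemma bounded_linear_cinner_left: "bounded_linear (\<lambda>f. cinner f g)"
proof (rule bounded_linear_intro[where K="norm g"])
  show "cinner (r *\<^sub>R f) g = r *\<^sub>R cinner f g" for r f
    by (simp add: scaleR_bergman_def cinner_scaleC_left scaleR_conv_of_real)
qed (simp_all add: cinner_add_left cinner_Cauchy_Schwarz)

lemma norm_normalized_kernel:
  assumes "w \<in> ball 0 1"
  shows "norm (normalized_kernel w) = 1"
proof -
  have "(cmod w)\<^sup>2 < 1" using assms by (simp add: power_less_one_iff)
  then have ne: "1 - complex_of_real ((cmod w)\<^sup>2) \<noteq> 0" by (metis of_real_1 of_real_eq_iff right_minus_eq less_irrefl)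
  have "cnj w * w = of_real ((cmod w)\<^sup>2)" by (simp only: complex_norm_square mult.commute)
  then have "cinner (normalized_kernel w) (normalized_kernel w) = 1"
    using ne assms unfolding cinner_normalized_kernel[OF assms]
    by (simp add: normalized_kernel.rep_eq power2_eq_square)
  then have "(norm (normalized_kernel w))\<^sup>2 = 1"
    by (metis cinner_self of_real_eq_1_iff)
  then show ?thesis by (simp add: power2_eq_1_iff) (smt (verit) norm_ge_zero)
qed

text \<open>
  Point evaluations are bounded, uniformly on compact subsets of the disc: norm convergence of
  Bergman functions implies locally uniform convergence.
\<close>

lemma bergman_pointwise_bound:
  assumes "cmod w < 1"
  shows "cmod (bergman_apply f w) \<le> norm f / (1 - (cmod w)\<^sup>2)"
proof -
  have pos: "0 < 1 - (cmod w)\<^sup>2" using assms by (simp add: power_less_one_iff)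
  have w: "w \<in> ball 0 1" using assms by simp
  have "(1 - (cmod w)\<^sup>2) * cmod (bergman_apply f w) = cmod (cinner f (normalized_kernel w))"
    using pos unfolding cinner_normalized_kernel[OF w] norm_mult norm_of_real by simp
  also have "\<dots> \<le> norm f"
    using cinner_Cauchy_Schwarz[of f "normalized_kernel w"] by (simp add: norm_normalized_kernel[OF w])
  finally show ?thesis using pos by (simp add: field_simps)
qed

lemma nn_integral_norm_bergman:
  "(\<integral>\<^sup>+z. ennreal ((cmod (bergman_apply f z))\<^sup>2) \<partial>disc_area) = ennreal ((norm f)\<^sup>2)"
proof -
  have "integrable disc_area (\<lambda>z. (cmod (bergman_apply f z))\<^sup>2)"
    using bergman_apply[of f] by (simp add: bergman_carrier_def)
  then show ?thesis
    by (subst nn_integral_eq_integral) (auto simp: norm_bergman_def)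
qed

text \<open>
  A Cauchy sequence converges locally uniformly, so the pointwise limit is holomorphic; Fatou's lemma
  shows that the limit is square-integrable and is the limit in norm.
\<close>

instance bergman :: complete_space
proof
  fix X :: "nat \<Rightarrow> bergman"
  assume X: "Cauchy X"
  define F where "F n = bergman_apply (X n)" for n
  define G where "G z = (if z \<in> ball 0 1 then lim (\<lambda>n. F n z) else 0)" for z
  have Fm[measurable]: "F n \<in> borel_measurable borel" for n
    unfolding F_def by (rule bergman_carrier_borel[OF bergman_apply])
  have F0: "F n z = 0" if "z \<notin> ball 0 1" for n z
    using bergman_apply[of "X n"] that by (simp add: F_def bergman_carrier_def)
  have unif: "uniform_limit (cball 0 s) F G sequentially" if s: "0 \<le> s" "s < 1" for s
  proof -
    have s2: "0 < 1 - s\<^sup>2" using s by (simp add: power_less_one_iff)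
    have "uniformly_Cauchy_on (cball 0 s) F"
      unfolding uniformly_Cauchy_on_def
    proof (intro allI impI)
      fix e :: real assume "e > 0"
      then have "e * (1 - s\<^sup>2) > 0" using s2 by simp
      then obtain N where N: "\<And>m n. m \<ge> N \<Longrightarrow> n \<ge> N \<Longrightarrow> norm (X m - X n) < e * (1 - s\<^sup>2)"
        using CauchyD[OF X] by blast
      show "\<exists>M. \<forall>z\<in>cball 0 s. \<forall>m\<ge>M. \<forall>n\<ge>M. dist (F m z) (F n z) < e"
      proof (intro exI ballI allI impI)
        fix z m n assume z: "z \<in> cball (0::complex) s" and mn: "m \<ge> N" "n \<ge> N"
        have zs: "(cmod z)\<^sup>2 \<le> s\<^sup>2" using z by (intro power_mono) auto
        have "cmod (bergman_apply (X m - X n) z) \<le> norm (X m - X n) / (1 - (cmod z)\<^sup>2)"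
          using z s by (intro bergman_pointwise_bound) auto
        also have "\<dots> \<le> norm (X m - X n) / (1 - s\<^sup>2)"
          using zs s2 by (intro divide_left_mono mult_pos_pos) auto
        also have "\<dots> < e" using N[OF mn] s2 by (simp add: field_simps)
        finally show "dist (F m z) (F n z) < e"
          by (simp add: F_def dist_norm minus_bergman.rep_eq)
      qed
    qed
    then have "uniform_limit (cball 0 s) F (\<lambda>z. lim (\<lambda>n. F n z)) sequentially"
      using Cauchy_uniformly_convergent uniformly_convergent_uniform_limit_iff by blast
    then show ?thesis
      by (rule uniform_limit_cong'[THEN iffD1, rotated -1]) (use s in \<open>auto simp: G_def\<close>)
  qed
  have lim: "(\<lambda>n. F n z) \<longlonglongrightarrow> G z" for z
  proof (cases "z \<in> ball 0 1")
    case True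
    then show ?thesis using tendsto_uniform_limitI[OF unif[of "cmod z"], of z] by simp
  qed (simp add: F0 G_def)
  have "G holomorphic_on ball 0 1"
  proof (rule holomorphic_uniform_sequence[where f=F])
    show "F n holomorphic_on ball 0 1" for n
      using bergman_apply[of "X n"] by (simp add: F_def bergman_carrier_def)
    fix z :: complex assume z: "z \<in> ball 0 1"
    define d where "d = (1 - cmod z) / 2"
    have "cball z d \<subseteq> cball 0 (cmod z + d)"
      by (auto simp: dist_norm) (smt (verit) norm_minus_commute norm_triangle_sub)
    moreover have "0 \<le> cmod z + d" "cmod z + d < 1" "0 < d" using z by (auto simp: d_def field_simps)
    ultimately show "\<exists>d>0. cball z d \<subseteq> ball 0 1 \<and> uniform_limit (cball z d) F G sequentially"
      by (intro exI[of _ d] conjI uniform_limit_on_subset[OF unif]) auto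
  qed simp
  have G0: "G z = 0" if "z \<notin> ball 0 1" for z
    using that by (simp only: G_def if_False)
  have Gm[measurable]: "G \<in> borel_measurable borel"
    by (rule borel_measurable_LIMSEQ_metric[OF Fm lim])
  have fatou: "\<exists>N. \<forall>n\<ge>N. (\<integral>\<^sup>+z. ennreal ((cmod (G z - F n z))\<^sup>2) \<partial>disc_area) \<le> ennreal (e\<^sup>2)"
    if e: "e > 0" for e
  proof -
    obtain N where N: "\<And>m n. m \<ge> N \<Longrightarrow> n \<ge> N \<Longrightarrow> norm (X m - X n) < e"
      using CauchyD[OF X e] by blast
    have "(\<integral>\<^sup>+z. ennreal ((cmod (G z - F n z))\<^sup>2) \<partial>disc_area) \<le> ennreal (e\<^sup>2)" if n: "n \<ge> N" for n
    proof -
      have "(\<lambda>m. ennreal ((cmod (F m z - F n z))\<^sup>2)) \<longlonglongrightarrow> ennreal ((cmod (G z - F n z))\<^sup>2)" for z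
        by (intro tendsto_ennrealI tendsto_intros lim)
      then have "(\<integral>\<^sup>+z. ennreal ((cmod (G z - F n z))\<^sup>2) \<partial>disc_area)
         = (\<integral>\<^sup>+z. liminf (\<lambda>m. ennreal ((cmod (F m z - F n z))\<^sup>2)) \<partial>disc_area)"
        by (intro nn_integral_cong) (metis lim_imp_Liminf trivial_limit_sequentially)
      also have "\<dots> \<le> liminf (\<lambda>m. \<integral>\<^sup>+z. ennreal ((cmod (F m z - F n z))\<^sup>2) \<partial>disc_area)"
        by (intro nn_integral_liminf) measurable
      also have "\<dots> \<le> ennreal (e\<^sup>2)"
      proof (intro Liminf_le)
        show "\<forall>\<^sub>F m in sequentially. (\<integral>\<^sup>+z. ennreal ((cmod (F m z - F n z))\<^sup>2) \<partial>disc_area) \<le> ennreal (e\<^sup>2)"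
        proof (rule eventually_sequentiallyI[of N])
          fix m assume m: "m \<ge> N"
          have "(\<integral>\<^sup>+z. ennreal ((cmod (F m z - F n z))\<^sup>2) \<partial>disc_area) = ennreal ((norm (X m - X n))\<^sup>2)"
            using nn_integral_norm_bergman[of "X m - X n"] by (simp add: F_def minus_bergman.rep_eq)
          also have "\<dots> \<le> ennreal (e\<^sup>2)"
            using N[OF m n] by (intro ennreal_leI power_mono) auto
          finally show "(\<integral>\<^sup>+z. ennreal ((cmod (F m z - F n z))\<^sup>2) \<partial>disc_area) \<le> ennreal (e\<^sup>2)" .
        qed
      qed simp
      finally show ?thesis .
    qed
    then show ?thesis by blast
  qed
  have G_carrier: "G \<in> bergman_carrier"
  proof -
    obtain N where N: "(\<integral>\<^sup>+z. ennreal ((cmod (G z - F N z))\<^sup>2) \<partial>disc_area) \<le> ennreal (1\<^sup>2)"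
      using fatou[of 1] by auto
    have "integrable disc_area (\<lambda>z. (cmod (G z - F N z))\<^sup>2)"
      by (rule integrableI_bounded) (use N in \<open>auto simp: le_less_trans\<close>)
    moreover have "F N \<in> bergman_carrier" unfolding F_def by (rule bergman_apply)
    ultimately have "(\<lambda>z. G z - F N z) \<in> bergman_carrier"
      using \<open>G holomorphic_on ball 0 1\<close> F0
      by (auto simp: bergman_carrier_def G0 intro!: holomorphic_on_diff)
    from bergman_carrier_add[OF this \<open>F N \<in> bergman_carrier\<close>] show ?thesis by simp
  qed
  define g where "g = Abs_bergman G"
  have g: "bergman_apply g = G" by (simp add: g_def Abs_bergman_inverse G_carrier)
  have "X \<longlonglongrightarrow> g"
  proof (rule LIMSEQ_I)
    fix e :: real assume e: "e > 0"
    then obtain N where N: "\<And>n. n \<ge> N \<Longrightarrow> (\<integral>\<^sup>+z. ennreal ((cmod (G z - F n z))\<^sup>2) \<partial>disc_area) \<le> ennreal ((e/2)\<^sup>2)"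
      using fatou[of "e/2"] by auto
    have "norm (X n - g) < e" if "n \<ge> N" for n
    proof -
      have "ennreal ((norm (g - X n))\<^sup>2) \<le> ennreal ((e/2)\<^sup>2)"
        using N[OF that] nn_integral_norm_bergman[of "g - X n"] by (simp add: F_def minus_bergman.rep_eq g)
      then have "(norm (g - X n))\<^sup>2 \<le> (e/2)\<^sup>2" by (subst (asm) ennreal_le_iff) auto
      then have "norm (g - X n) \<le> e/2" by (rule power2_le_imp_le) (use e in simp)
      then show ?thesis using e by (simp add: norm_minus_commute)
    qed
    then show "\<exists>N. \<forall>n\<ge>N. norm (X n - g) < e" by blast
  qed
  then show "convergent X" by (auto simp: convergent_def)
qed

section \<open>Representation of functionals and uniform boundedness\<close>

text \<open>
  A Riesz representation theorem for a functional that is defined on the range of a linear map only.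
  The functional \<open>q x = \<parallel>T x\<parallel>\<^sup>2 - 2 \<phi> x\<close> is bounded below. By the parallelogram law a minimizing sequence
  has a convergent image under \<open>T\<close>, and the first variation at the limit is the desired identity.
  With \<open>T\<close> the identity this is
  the usual Riesz theorem; with \<open>T\<close> an analysis operator it provides the coefficients of an expansion.
\<close>

lemma riesz_on_range:
  fixes T :: "'b::real_vector \<Rightarrow> 'a::{real_inner,complete_space}" and \<phi> :: "'b \<Rightarrow> real"
  assumes T: "linear T" and \<phi>: "linear \<phi>" and bound: "\<And>x. \<bar>\<phi> x\<bar> \<le> K * norm (T x)"
  obtains a where "a \<in> closure (range T)" "\<And>x. inner (T x) a = \<phi> x"
proof -
  define q where "q x = (norm (T x))\<^sup>2 - 2 * \<phi> x" for x
  have "- (K\<^sup>2) \<le> q x" for x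
    using bound[of x] zero_le_power2[of "norm (T x) - K"]
    by (auto simp: q_def power2_diff abs_le_iff mult.commute)
  then have bdd: "bdd_below (range q)" by (auto intro!: bdd_belowI2)
  define m where "m = (INF x. q x)"
  have m: "m \<le> q x" for x unfolding m_def using bdd by (auto intro: cINF_lower)
  have "\<exists>x. q x < m + 1 / Suc n" for n
    using cInf_lessD[of "range q" "m + 1 / Suc n"] by (auto simp: m_def)
  then obtain X where X: "\<And>n. q (X n) < m + 1 / Suc n" by metis
  have dist_X: "(norm (T (X n) - T (X k)))\<^sup>2 \<le> 2 / Suc n + 2 / Suc k" for n k
  proof -
    \<comment> \<open>The value of \<open>q\<close> at the midpoint is at least the infimum, which bounds the distance.\<close>
    define y where "y = (1/2) *\<^sub>R (X n + X k)"
    have Ty: "T y = (1/2) *\<^sub>R (T (X n) + T (X k))" "\<phi> y = (\<phi> (X n) + \<phi> (X k)) / 2"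
      by (simp_all add: y_def linear_add[OF T] linear_scale[OF T] linear_add[OF \<phi>] linear_scale[OF \<phi>])
    have "(norm (T (X n) - T (X k)))\<^sup>2 = 2 * q (X n) + 2 * q (X k) - 4 * q y"
      unfolding q_def Ty
      by (simp add: power2_norm_eq_inner inner_simps inner_commute algebra_simps)
    also have "\<dots> \<le> 2 / Suc n + 2 / Suc k"
      using X[of n] X[of k] m[of y] by simp
    finally show ?thesis .
  qed
  have "Cauchy (\<lambda>n. T (X n))"
  proof (rule metric_CauchyI)
    fix e :: real assume e: "e > 0"
    obtain N where N: "4 / e\<^sup>2 < real N" using reals_Archimedean2 by blast
    show "\<exists>M. \<forall>n\<ge>M. \<forall>k\<ge>M. dist (T (X n)) (T (X k)) < e"
    proof (intro exI allI impI)
      fix n k assume nk: "N \<le> n" "N \<le> k"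
      have Np: "4 / e\<^sup>2 < real (Suc N)" using N by simp
      have "2 / Suc n + 2 / Suc k \<le> 2 / Suc N + 2 / Suc N"
        using nk by (intro add_mono divide_left_mono) auto
      also have "\<dots> < e\<^sup>2" using Np e by (simp add: field_simps del: of_nat_Suc)
      finally have "(norm (T (X n) - T (X k)))\<^sup>2 < e\<^sup>2" using dist_X[of n k] by linarith
      then show "dist (T (X n)) (T (X k)) < e"
        using e by (simp add: dist_norm power2_less_imp_less)
    qed
  qed
  then obtain a where a: "(\<lambda>n. T (X n)) \<longlonglongrightarrow> a"
    using Cauchy_convergent_iff convergent_def by blast
  have "inner (T x) a = \<phi> x" for x
  proof -
    define c where "c = inner a (T x) - \<phi> x"
    define s where "s = (norm (T x))\<^sup>2"
    have quad: "0 \<le> 2 * t * c + t\<^sup>2 * s" for t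
    proof -
      have q_exp: "q (X n + t *\<^sub>R x) = q (X n) + 2 * t * (inner (T (X n)) (T x) - \<phi> x) + t\<^sup>2 * s" for n
        unfolding q_def s_def linear_add[OF T] linear_scale[OF T] linear_add[OF \<phi>] linear_scale[OF \<phi>]
        by (simp add: power2_norm_eq_inner inner_simps inner_commute algebra_simps power2_eq_square[of t])
      have "0 \<le> 1 / Suc n + 2 * t * (inner (T (X n)) (T x) - \<phi> x) + t\<^sup>2 * s" for n
        using m[of "X n + t *\<^sub>R x"] X[of n] unfolding q_exp by linarith
      moreover have "(\<lambda>n. 1 / Suc n + 2 * t * (inner (T (X n)) (T x) - \<phi> x) + t\<^sup>2 * s)
          \<longlonglongrightarrow> 0 + 2 * t * (inner a (T x) - \<phi> x) + t\<^sup>2 * s"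
        by (intro tendsto_intros a LIMSEQ_inverse_real_of_nat[unfolded inverse_eq_divide])
      ultimately show ?thesis
        by (auto simp: c_def intro: LIMSEQ_le_const)
    qed
    have s: "s \<ge> 0" by (simp add: s_def)
    \<comment> \<open>The minimizer of the quadratic, with \<open>s + 1\<close> in place of \<open>s\<close> to allow \<open>s = 0\<close>.\<close>
    define t where "t = - c / (s + 1)"
    have t: "t * (s + 1) = - c" using s by (simp add: t_def)
    have "0 \<le> (2 * t * c + t\<^sup>2 * s) * (s + 1)\<^sup>2"
      using quad[of t] by simp
    also have "\<dots> = 2 * (t * (s + 1)) * c * (s + 1) + (t * (s + 1))\<^sup>2 * s"
      by (simp add: power2_eq_square algebra_simps)
    also have "\<dots> = - (c\<^sup>2 * (s + 2))"
      unfolding t by (simp add: algebra_simps power2_eq_square)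
    finally have "c\<^sup>2 \<le> 0" using s by (simp add: mult_le_0_iff)
    then show ?thesis by (simp add: c_def inner_commute)
  qed
  moreover have "a \<in> closure (range T)"
    unfolding closure_sequential by (intro exI[of _ "\<lambda>n. T (X n)"]) (simp add: a)
  ultimately show thesis using that by blast
qed

text \<open>
  On the closure of \<open>S\<close> the bound on the functional \<open>\<lambda>x. inner x a\<close> may be tested at \<open>a\<close> itself. With
  \<open>K = 0\<close> this says that only 0 is orthogonal to \<open>S\<close> and in its closure.
\<close>

lemma closure_inner_bound:
  fixes a :: "'a::real_inner"
  assumes "a \<in> closure S" "\<And>x. x \<in> S \<Longrightarrow> inner x a \<le> K * norm x" "0 \<le> K"
  shows "norm a \<le> K"
proof -
  obtain X where X: "\<And>n. X n \<in> S" "X \<longlonglongrightarrow> a" using assms(1) unfolding closure_sequential by blast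
  have "inner a a \<le> K * norm a"
    by (rule LIMSEQ_le[of "\<lambda>n. inner (X n) a" _ "\<lambda>n. K * norm (X n)"])
       (use X assms(2) in \<open>auto intro!: tendsto_intros\<close>)
  then have "norm a * norm a \<le> K * norm a" by (simp add: norm_eq_sqrt_inner)
  then show ?thesis using assms(3) by (cases "a = 0") auto
qed

text \<open>
  The Banach-Steinhaus argument: by Baire's theorem one of the closed sets on which all seminorms are
  at most \<open>k\<close> contains a ball, and subadditivity moves that ball to the origin.
\<close>

lemma uniform_boundedness_seminorms:
  fixes p :: "nat \<Rightarrow> 'a::banach \<Rightarrow> real"
  assumes cont: "\<And>n. continuous_on UNIV (p n)"
    and tri: "\<And>n x y. p n (x + y) \<le> p n x + p n y"
    and scale: "\<And>n r x. p n (r *\<^sub>R x) = \<bar>r\<bar> * p n x"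
    and bdd: "\<And>x. \<exists>M. \<forall>n. p n x \<le> M"
  obtains M where "M > 0" "\<And>n x. p n x \<le> M * norm x"
proof -
  define A where "A k = {x. \<forall>n. p n x \<le> real k}" for k
  have closed: "closed (A k)" for k
  proof -
    have "closed {x. p n x \<le> real k}" for n
      using cont by (intro closed_Collect_le continuous_on_const) auto
    then show ?thesis unfolding A_def by (simp add: Collect_all_eq closed_INT)
  qed
  have "(\<Union>k. A k) = UNIV"
  proof -
    have "\<exists>k. x \<in> A k" for x
    proof -
      obtain M where M: "\<And>n. p n x \<le> M" using bdd by blast
      obtain k where "M \<le> real k" using real_arch_simple by blast
      then have "x \<in> A k" unfolding A_def using M order_trans by blast
      then show ?thesis ..
    qed
    then show ?thesis by auto
  qed
  moreover have "\<exists>k. interior (A k) \<noteq> {}"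
  proof (rule ccontr)
    assume "\<nexists>k. interior (A k) \<noteq> {}"
    then have "euclidean interior_of \<Union>(range A) = {}"
      using closed completely_metrizable_space_euclidean by (intro Baire_category_alt) auto
    with calculation show False by (simp)
  qed
  then obtain k x0 where "x0 \<in> interior (A k)" by blast
  then obtain e where e: "e > 0" "ball x0 e \<subseteq> A k"
    by (auto simp: mem_interior)
  have neg: "p n (- x) = p n x" for n x using scale[of n "-1" x] by simp
  have small: "p n y \<le> 2 * real k" if "norm y < e" for n y
  proof -
    have "x0 + y \<in> ball x0 e" "x0 \<in> ball x0 e" using that e by (auto simp: dist_norm)
    then have "x0 + y \<in> A k" "x0 \<in> A k" using e by blast+
    then have "p n (x0 + y) \<le> k" "p n x0 \<le> k" by (simp_all add: A_def)
    then show ?thesis using tri[of n "x0 + y" "- x0"] neg[of n x0] by simp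
  qed
  have "p n x \<le> (4 * real k / e + 1) * norm x" for n x
  proof (cases "x = 0")
    case True then show ?thesis using scale[of n 0 x] by simp
  next
    case False
    define t where "t = e / (2 * norm x)"
    have t: "t > 0" using False e by (simp add: t_def)
    have "norm (t *\<^sub>R x) < e" using False e by (simp add: t_def)
    from small[OF this, of n] have "t * p n x \<le> 2 * real k" using scale[of n t x] t by simp
    then have "p n x \<le> 4 * real k / e * norm x"
      using False e by (simp add: t_def field_simps)
    then show ?thesis by (simp add: distrib_right add_increasing2)
  qed
  moreover have "4 * real k / e + 1 > 0" using e by (simp add: add_nonneg_pos)
  ultimately show thesis using that by blast
qed

section \<open>The Hilbert space of square-summable sequences\<close>

lemma ell2_add: "ell2 a \<Longrightarrow> ell2 b \<Longrightarrow> ell2 (\<lambda>n. a n + b n)"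
proof -
  assume "ell2 a" "ell2 b"
  then have sm: "summable (\<lambda>n. 2 * (cmod (a n))\<^sup>2 + 2 * (cmod (b n))\<^sup>2)"
    unfolding ell2_def by (intro summable_add summable_mult)
  have "(cmod (a n + b n))\<^sup>2 \<le> 2 * (cmod (a n))\<^sup>2 + 2 * (cmod (b n))\<^sup>2" for n
  proof -
    have "(cmod (a n + b n))\<^sup>2 \<le> (cmod (a n) + cmod (b n))\<^sup>2"
      by (intro power_mono norm_triangle_ineq) auto
    then show ?thesis using zero_le_power2[of "cmod (a n) - cmod (b n)"]
      by (simp add: power2_sum power2_diff)
  qed
  then show ?thesis unfolding ell2_def by (intro summable_comparison_test'[OF sm]) auto
qed

lemma ell2_cmult: "ell2 a \<Longrightarrow> ell2 (\<lambda>n. c * a n)"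
  unfolding ell2_def by (simp add: norm_mult power_mult_distrib summable_mult)

lemma ell2_summable_mult:
  assumes "ell2 a" "ell2 b"
  shows "summable (\<lambda>n. cmod (a n * cnj (b n)))"
proof (rule summable_comparison_test'[where N=0])
  show "summable (\<lambda>n. (cmod (a n))\<^sup>2 + (cmod (b n))\<^sup>2)"
    using assms unfolding ell2_def by (rule summable_add)
  show "norm (cmod (a n * cnj (b n))) \<le> (cmod (a n))\<^sup>2 + (cmod (b n))\<^sup>2" for n
    using zero_le_power2[of "cmod (a n) - cmod (b n)"]
      mult_nonneg_nonneg[OF norm_ge_zero[of "a n"] norm_ge_zero[of "b n"]]
    unfolding power2_diff norm_mult complex_mod_cnj real_norm_def abs_mult abs_norm_cancel by linarith
qed

text \<open>
  Square-summable sequences as a type, so that the uniform boundedness principle and the Riesz theorem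
  above can be used for coefficient sequences.
\<close>

typedef ell2_seq = "{c. ell2 c}" morphisms entry Abs_ell2_seq
  by (rule exI[of _ "\<lambda>_. 0"]) (simp add: ell2_def)

setup_lifting type_definition_ell2_seq

lemma ell2_entry: "ell2 (entry c)" using entry[of c] by simp

instantiation ell2_seq :: real_inner
begin

lift_definition zero_ell2_seq :: ell2_seq is "\<lambda>_. 0" by (simp add: ell2_def)
lift_definition plus_ell2_seq :: "ell2_seq \<Rightarrow> ell2_seq \<Rightarrow> ell2_seq" is "\<lambda>a b n. a n + b n"
  by (rule ell2_add)
lift_definition uminus_ell2_seq :: "ell2_seq \<Rightarrow> ell2_seq" is "\<lambda>a n. - a n" by (simp add: ell2_def)
lift_definition minus_ell2_seq :: "ell2_seq \<Rightarrow> ell2_seq \<Rightarrow> ell2_seq" is "\<lambda>a b n. a n - b n"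
  using ell2_add[OF _ ell2_cmult[of _ "-1"]] by simp
lift_definition scaleR_ell2_seq :: "real \<Rightarrow> ell2_seq \<Rightarrow> ell2_seq" is "\<lambda>r a n. of_real r * a n"
  by (rule ell2_cmult)
lift_definition inner_ell2_seq :: "ell2_seq \<Rightarrow> ell2_seq \<Rightarrow> real" is
  "\<lambda>a b. \<Sum>n. Re (a n * cnj (b n))" .
lift_definition norm_ell2_seq :: "ell2_seq \<Rightarrow> real" is ell2_norm .
definition sgn_ell2_seq :: "ell2_seq \<Rightarrow> ell2_seq" where "sgn_ell2_seq f = inverse (norm f) *\<^sub>R f"
definition dist_ell2_seq :: "ell2_seq \<Rightarrow> ell2_seq \<Rightarrow> real" where "dist_ell2_seq f g = norm (f - g)"
definition uniformity_ell2_seq :: "(ell2_seq \<times> ell2_seq) filter" where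
  "uniformity_ell2_seq = (INF e\<in>{0<..}. principal {(x, y). dist x y < e})"
definition open_ell2_seq :: "ell2_seq set \<Rightarrow> bool" where
  "open_ell2_seq U = (\<forall>x\<in>U. eventually (\<lambda>(x', y). x' = x \<longrightarrow> y \<in> U) uniformity)"

instance
proof
  fix a b c :: ell2_seq and r s :: real
  show "a + b + c = a + (b + c)" "a + b = b + a" "0 + a = a" "- a + a = 0" "a - b = a + - b"
    "r *\<^sub>R (a + b) = r *\<^sub>R a + r *\<^sub>R b" "(r + s) *\<^sub>R a = r *\<^sub>R a + s *\<^sub>R a"
    "r *\<^sub>R s *\<^sub>R a = (r * s) *\<^sub>R a" "1 *\<^sub>R a = a"
    by (transfer; simp add: fun_eq_iff algebra_simps)+
  have sm: "summable (\<lambda>n. Re (entry a n * cnj (entry b n)))" for a b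
    by (intro summable_Re summable_norm_cancel[OF ell2_summable_mult] ell2_entry)
  show "inner a b = inner b a"
    unfolding inner_ell2_seq.rep_eq by (simp add: mult.commute)
  show "inner (a + b) c = inner a c + inner b c"
    unfolding inner_ell2_seq.rep_eq plus_ell2_seq.rep_eq
    by (subst suminf_add[OF sm sm]) (simp add: algebra_simps)
  show "inner (r *\<^sub>R a) b = r * inner a b"
    unfolding inner_ell2_seq.rep_eq scaleR_ell2_seq.rep_eq
    by (subst suminf_mult[OF sm, symmetric]) (simp add: algebra_simps)
  have self: "Re (entry a n * cnj (entry a n)) = (cmod (entry a n))\<^sup>2" for n
    by (simp add: complex_norm_square[symmetric] del: of_real_power)
  have sa: "summable (\<lambda>n. (cmod (entry a n))\<^sup>2)" using ell2_entry by (simp add: ell2_def)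
  show "0 \<le> inner a a" "norm a = sqrt (inner a a)"
    unfolding inner_ell2_seq.rep_eq norm_ell2_seq.rep_eq self ell2_norm_def
    by (auto intro: suminf_nonneg sa)
  show "inner a a = 0 \<longleftrightarrow> a = 0"
    unfolding inner_ell2_seq.rep_eq self using suminf_eq_zero_iff[OF sa]
    by (simp add: entry_inject[symmetric] zero_ell2_seq.rep_eq fun_eq_iff)
qed (simp_all add: sgn_ell2_seq_def dist_ell2_seq_def uniformity_ell2_seq_def open_ell2_seq_def)

end

lemma norm_ell2_seq_square: "(norm c)\<^sup>2 = (\<Sum>n. (cmod (entry c n))\<^sup>2)"
  using ell2_entry[of c] by (simp add: norm_ell2_seq.rep_eq ell2_norm_def ell2_def suminf_nonneg)

lemma sum_entry_le: "(\<Sum>n<N. (cmod (entry c n))\<^sup>2) \<le> (norm c)\<^sup>2"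
  using ell2_entry[of c] unfolding norm_ell2_seq_square ell2_def by (intro sum_le_suminf) auto

lemma norm_entry_le: "cmod (entry c n) \<le> norm c"
proof -
  have "(cmod (entry c n))\<^sup>2 \<le> (\<Sum>k<Suc n. (cmod (entry c k))\<^sup>2)"
    by (rule member_le_sum) auto
  also have "\<dots> \<le> (norm c)\<^sup>2" by (rule sum_entry_le)
  finally show ?thesis by (rule power2_le_imp_le) simp
qed

text \<open>
  A Cauchy sequence converges in every entry, and the bounds on its partial sums of squares pass to
  the limit.
\<close>

instance ell2_seq :: complete_space
proof
  fix X :: "nat \<Rightarrow> ell2_seq"
  assume X: "Cauchy X"
  have "Cauchy (\<lambda>m. entry (X m) n)" for n
  proof (rule CauchyI)
    fix e :: real assume "e > 0"
    then obtain M where M: "\<And>i j. i \<ge> M \<Longrightarrow> j \<ge> M \<Longrightarrow> norm (X i - X j) < e"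
      using CauchyD[OF X] by blast
    have "norm (entry (X i) n - entry (X j) n) < e" if "i \<ge> M" "j \<ge> M" for i j
      using norm_entry_le[of "X i - X j" n] M[OF that] by (simp add: minus_ell2_seq.rep_eq)
    then show "\<exists>M. \<forall>i\<ge>M. \<forall>j\<ge>M. norm (entry (X i) n - entry (X j) n) < e" by blast
  qed
  then have "\<exists>y. (\<lambda>m. entry (X m) n) \<longlonglongrightarrow> y" for n
    using Cauchy_convergent_iff convergent_def by blast
  then obtain y where y: "\<And>n. (\<lambda>m. entry (X m) n) \<longlonglongrightarrow> y n" by metis
  have partial: "\<exists>M. \<forall>i\<ge>M. \<forall>N. (\<Sum>n<N. (cmod (y n - entry (X i) n))\<^sup>2) \<le> e\<^sup>2" if e: "e > 0" for e
  proof -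
    obtain M where M: "\<And>i j. i \<ge> M \<Longrightarrow> j \<ge> M \<Longrightarrow> norm (X i - X j) < e" using CauchyD[OF X e] by blast
    have "(\<Sum>n<N. (cmod (y n - entry (X i) n))\<^sup>2) \<le> e\<^sup>2" if i: "i \<ge> M" for i N
    proof (rule LIMSEQ_le_const2)
      show "(\<lambda>j. \<Sum>n<N. (cmod (entry (X j) n - entry (X i) n))\<^sup>2)
          \<longlonglongrightarrow> (\<Sum>n<N. (cmod (y n - entry (X i) n))\<^sup>2)"
        by (intro tendsto_intros y)
      have "(\<Sum>n<N. (cmod (entry (X j) n - entry (X i) n))\<^sup>2) \<le> e\<^sup>2" if "j \<ge> M" for j
      proof -
        have "(\<Sum>n<N. (cmod (entry (X j) n - entry (X i) n))\<^sup>2) \<le> (norm (X j - X i))\<^sup>2"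
          using sum_entry_le[of "X j - X i" N] by (simp add: minus_ell2_seq.rep_eq)
        also have "\<dots> \<le> e\<^sup>2" using M[OF that i] by (intro power_mono) auto
        finally show ?thesis .
      qed
      then show "\<exists>J. \<forall>j\<ge>J. (\<Sum>n<N. (cmod (entry (X j) n - entry (X i) n))\<^sup>2) \<le> e\<^sup>2" by blast
    qed
    then show ?thesis by blast
  qed
  have tail: "ell2 (\<lambda>n. y n - entry (X i) n) \<and> (\<Sum>n. (cmod (y n - entry (X i) n))\<^sup>2) \<le> e\<^sup>2"
    if "\<forall>N. (\<Sum>n<N. (cmod (y n - entry (X i) n))\<^sup>2) \<le> e\<^sup>2" for i e
  proof -
    have "summable (\<lambda>n. (cmod (y n - entry (X i) n))\<^sup>2)"
      by (rule summableI_nonneg_bounded[of _ "e\<^sup>2"]) (use that in auto)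
    then show ?thesis using that by (auto simp: ell2_def intro!: suminf_le_const)
  qed
  have "ell2 y"
  proof -
    obtain i where "\<forall>N. (\<Sum>n<N. (cmod (y n - entry (X i) n))\<^sup>2) \<le> 1\<^sup>2"
      using partial[OF zero_less_one] by blast
    then have "ell2 (\<lambda>n. y n - entry (X i) n)" using tail by blast
    from ell2_add[OF this ell2_entry[of "X i"]] show ?thesis by simp
  qed
  then have ent: "entry (Abs_ell2_seq y) = y" by (simp add: Abs_ell2_seq_inverse)
  have "X \<longlonglongrightarrow> Abs_ell2_seq y"
  proof (rule LIMSEQ_I)
    fix e :: real assume e: "e > 0"
    then obtain M where M: "\<forall>i\<ge>M. \<forall>N. (\<Sum>n<N. (cmod (y n - entry (X i) n))\<^sup>2) \<le> (e/2)\<^sup>2"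
      using partial[of "e/2"] by auto
    have "norm (X i - Abs_ell2_seq y) < e" if "i \<ge> M" for i
    proof -
      have "(norm (Abs_ell2_seq y - X i))\<^sup>2 \<le> (e/2)\<^sup>2"
        using tail M that unfolding norm_ell2_seq_square by (simp add: minus_ell2_seq.rep_eq ent)
      then have "norm (Abs_ell2_seq y - X i) \<le> e/2" by (rule power2_le_imp_le) (use e in simp)
      then show ?thesis using e by (simp add: norm_minus_commute)
    qed
    then show "\<exists>M. \<forall>i\<ge>M. norm (X i - Abs_ell2_seq y) < e" by blast
  qed
  then show "convergent X" by (auto simp: convergent_def)
qed

instance ell2_seq :: banach ..
instance bergman :: banach ..

section \<open>Adjoints and Bessel sequences in the Bergman space\<close>

lemma cinner_sum_left: "cinner (\<Sum>n\<in>I. f n) g = (\<Sum>n\<in>I. cinner (f n) g)"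
  using linear_sum[OF bounded_linear.linear[OF bounded_linear_cinner_left[of g]]] .

lemma cmod_cinner_commute: "cmod (cinner f g) = cmod (cinner g f)"
  by (metis cinner_commute complex_mod_cnj)

text \<open>
  The real inner product is the real part of the complex one, so vectors that define the same
  complex functional define the same real functional.
\<close>

lemma bergman_eqI:
  assumes "\<And>f. cinner g f = cinner h f"
  shows "g = h"
proof -
  have "\<forall>f. inner f g = inner f h"
    using assms by (metis Re_cinner inner_commute)
  then show ?thesis by (simp only: vector_eq_ldot)
qed

text \<open>
  The real Riesz theorem represents the real part of \<open>\<phi>\<close>; by complex homogeneity the imaginary
  part of \<open>\<phi> f\<close> is the real part of \<open>\<phi> (- \<i> f)\<close>.
\<close>

lemma riesz_cinner:
  assumes add: "\<And>f g. \<phi> (f + g) = \<phi> f + \<phi> g"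
    and scale: "\<And>c f. \<phi> (c *\<^sub>C f) = c * \<phi> f"
    and bound: "\<And>f. cmod (\<phi> f) \<le> K * norm f"
  obtains h where "\<And>f. \<phi> f = cinner f h"
proof -
  have lin: "linear (\<lambda>f. Re (\<phi> f))"
    by (rule linearI) (simp_all add: add scale scaleR_bergman_def)
  have "\<bar>Re (\<phi> f)\<bar> \<le> K * norm f" for f
    using abs_Re_le_cmod[of "\<phi> f"] bound[of f] by linarith
  then obtain h where h: "\<And>f. inner f h = Re (\<phi> f)"
    using riesz_on_range[of "\<lambda>f. f", OF linear_ident lin] by blast
  have "\<phi> f = cinner f h" for f
  proof (rule complex_eqI)
    have "Im (\<phi> f) = Re (\<phi> ((- \<i>) *\<^sub>C f))" by (simp add: scale)
    also have "\<dots> = Re (cinner ((- \<i>) *\<^sub>C f) h)" by (simp only: h[symmetric] Re_cinner)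
    also have "\<dots> = Im (cinner f h)" by (simp add: cinner_scaleC_left)
    finally show "Im (\<phi> f) = Im (cinner f h)" .
  qed (simp add: h[symmetric] Re_cinner)
  then show thesis by (rule that)
qed

lemma hilbert_adjoint:
  assumes "bounded_clinear L"
  shows "cinner (L f) g = cinner f (hilbert_adjoint L g)"
proof -
  have bl: "bounded_linear L" and scale: "\<And>c f. L (c *\<^sub>C f) = c *\<^sub>C L f"
    using assms by (auto simp: bounded_clinear_def)
  obtain K where K: "\<And>f. norm (L f) \<le> norm f * K" using bounded_linear.bounded[OF bl] by blast
  have "\<exists>h. \<forall>f. cinner (L f) g = cinner f h" for g
  proof (rule riesz_cinner[where \<phi>="\<lambda>f. cinner (L f) g" and K="K * norm g"])
    show "cmod (cinner (L f) g) \<le> K * norm g * norm f" for f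
      using cinner_Cauchy_Schwarz[of "L f" g] mult_right_mono[OF K[of f], of "norm g"]
      by (simp add: mult_ac)
  qed (auto simp: linear_add[OF bounded_linear.linear[OF bl]] scale cinner_add_left cinner_scaleC_left)
  then obtain M where M: "\<forall>f g. cinner (L f) g = cinner f (M g)" by metis
  have "hilbert_adjoint L = M"
    unfolding hilbert_adjoint_def
  proof (rule the_equality)
    fix M' assume M': "\<forall>f g. cinner (L f) g = cinner f (M' g)"
    show "M' = M"
    proof
      fix g
      have "cinner (M' g) f = cinner (M g) f" for f
        using M M' by (metis cinner_commute)
      then show "M' g = M g" by (rule bergman_eqI)
    qed
  qed (rule M)
  then show ?thesis using M by simp
qed

lemma bessel_sequenceD:
  assumes "bessel_sequence g"
  obtains B where "B > 0"
    "\<And>f I. finite I \<Longrightarrow> (\<Sum>n\<in>I. (cmod (cinner f (g n)))\<^sup>2) \<le> B * (norm f)\<^sup>2"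
proof -
  obtain B where B: "B > 0" "\<And>f. summable (\<lambda>n. (cmod (cinner f (g n)))\<^sup>2)"
    "\<And>f. (\<Sum>n. (cmod (cinner f (g n)))\<^sup>2) \<le> B * (norm f)\<^sup>2"
    using assms by (auto simp: bessel_sequence_def)
  have "(\<Sum>n\<in>I. (cmod (cinner f (g n)))\<^sup>2) \<le> B * (norm f)\<^sup>2" if "finite I" for f I
    using sum_le_suminf[OF B(2)[of f] that] B(3)[of f] by fastforce
  then show thesis using B that by blast
qed

lemma bessel_sequenceI:
  assumes "B > 0" "\<And>f N. (\<Sum>n<N. (cmod (cinner f (g n)))\<^sup>2) \<le> B * (norm f)\<^sup>2"
  shows "bessel_sequence g"
  unfolding bessel_sequence_def
proof (intro exI[of _ B] conjI allI assms(1))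
  fix f
  show sm: "summable (\<lambda>n. (cmod (cinner f (g n)))\<^sup>2)"
    by (rule summableI_nonneg_bounded[of _ "B * (norm f)\<^sup>2"]) (use assms in auto)
  show "(\<Sum>n. (cmod (cinner f (g n)))\<^sup>2) \<le> B * (norm f)\<^sup>2"
    using sm assms by (intro suminf_le_const)
qed

text \<open>
  A pointwise bound on the coefficients is automatically uniform: the seminorms
  \<open>f \<mapsto> (\<Sum>n<N. |\<langle>f, e\<^sub>n\<rangle>|\<^sup>2)\<^bsup>1/2\<^esup>\<close> are continuous and pointwise bounded in \<open>N\<close>.
\<close>

lemma bessel_sequence_if_square_summable:
  assumes sm: "\<And>f. summable (\<lambda>n. (cmod (cinner f (e n)))\<^sup>2)"
  shows "bessel_sequence e"
proof -
  define p where "p N f = L2_set (\<lambda>n. cmod (cinner f (e n))) {..<N}" for N f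
  have p_sq: "(p N f)\<^sup>2 = (\<Sum>n<N. (cmod (cinner f (e n)))\<^sup>2)" for N f
    by (simp add: p_def L2_set_def sum_nonneg)
  have cont: "continuous_on UNIV (p N)" for N
    unfolding p_def L2_set_def
    by (intro continuous_intros bounded_linear.continuous_on[OF bounded_linear_cinner_left])
  have tri: "p N (f + g) \<le> p N f + p N g" for N f g
  proof -
    have "p N (f + g) \<le> L2_set (\<lambda>n. cmod (cinner f (e n)) + cmod (cinner g (e n))) {..<N}"
      unfolding p_def cinner_add_left by (intro L2_set_mono norm_triangle_ineq) auto
    also have "\<dots> \<le> p N f + p N g" unfolding p_def by (rule L2_set_triangle_ineq)
    finally show ?thesis .
  qed
  have scale: "p N (r *\<^sub>R f) = \<bar>r\<bar> * p N f" for N r f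
    by (simp add: p_def scaleR_bergman_def cinner_scaleC_left norm_mult L2_set_right_distrib)
  have bdd: "\<exists>M. \<forall>N. p N f \<le> M" for f
  proof (intro exI allI)
    fix N
    have "(p N f)\<^sup>2 \<le> (\<Sum>n. (cmod (cinner f (e n)))\<^sup>2)"
      unfolding p_sq by (intro sum_le_suminf sm) auto
    then show "p N f \<le> sqrt (\<Sum>n. (cmod (cinner f (e n)))\<^sup>2)" by (rule real_le_rsqrt)
  qed
  obtain M where M: "M > 0" "\<And>N f. p N f \<le> M * norm f"
    using uniform_boundedness_seminorms[of p, OF cont tri scale bdd] by blast
  show ?thesis
  proof (rule bessel_sequenceI[where B="M\<^sup>2"])
    fix f N
    have "(p N f)\<^sup>2 \<le> (M * norm f)\<^sup>2"
      using M(2)[of N f] by (intro power_mono) (auto simp: p_def)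
    then show "(\<Sum>n<N. (cmod (cinner f (e n)))\<^sup>2) \<le> M\<^sup>2 * (norm f)\<^sup>2"
      by (simp add: p_sq power_mult_distrib)
  qed (use M in simp)
qed

lemma bounded_linear_entry_scaleC: "bounded_linear (\<lambda>c. entry c n *\<^sub>C f)"
proof (rule bounded_linear_intro[where K="norm f"])
  show "entry (a + b) n *\<^sub>C f = entry a n *\<^sub>C f + entry b n *\<^sub>C f" for a b
    unfolding plus_ell2_seq.rep_eq by transfer (simp add: fun_eq_iff algebra_simps)
  show "entry (r *\<^sub>R a) n *\<^sub>C f = r *\<^sub>R (entry a n *\<^sub>C f)" for r a
    by (simp add: scaleR_ell2_seq.rep_eq scaleR_bergman_def scaleC_scaleC)
  show "norm (entry c n *\<^sub>C f) \<le> norm c * norm f" for c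
    by (simp add: norm_scaleC mult_right_mono norm_entry_le)
qed

lemma norm_sq_le_imp:
  fixes x y :: real
  assumes "x\<^sup>2 \<le> y * x" "0 \<le> x" "0 \<le> y"
  shows "x \<le> y"
  using assms by (cases "x = 0") (auto simp: power2_eq_square)

text \<open>
  Uniform boundedness on the space of square-summable sequences bounds the partial synthesis
  operators by a common \<open>M\<close>. Testing them on the first \<open>N\<close> coefficients of \<open>f\<close> gives the Bessel
  inequality with constant \<open>M\<^sup>2\<close>.
\<close>

lemma bessel_sequence_if_synthesis_converges:
  assumes sm: "\<And>c. ell2 c \<Longrightarrow> summable (\<lambda>n. c n *\<^sub>C e n)"
  shows "bessel_sequence e"
proof -
  define S where "S N c = (\<Sum>n<N. entry c n *\<^sub>C e n)" for N c
  have bl: "bounded_linear (S N)" for N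
    unfolding S_def by (intro bounded_linear_sum bounded_linear_entry_scaleC)
  have lin: "linear (S N)" for N by (rule bounded_linear.linear[OF bl])
  have bdd: "\<exists>M. \<forall>N. norm (S N c) \<le> M" for c
  proof -
    have "convergent (\<lambda>N. S N c)"
      using sm[OF ell2_entry[of c]] unfolding S_def summable_iff_convergent .
    then have "Bseq (\<lambda>N. S N c)" by (rule convergent_imp_Bseq)
    then show ?thesis by (auto simp: Bseq_def)
  qed
  obtain M where M: "M > 0" "\<And>N c. norm (S N c) \<le> M * norm c"
    using uniform_boundedness_seminorms[of "\<lambda>N c. norm (S N c)"] bdd
      bounded_linear.continuous_on[OF bl continuous_on_id]
    by (auto simp: linear_add[OF lin] linear_scale[OF lin] norm_triangle_ineq continuous_on_norm)
  show ?thesis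
  proof (rule bessel_sequenceI[where B="M\<^sup>2"])
    fix f N
    define c where "c n = (if n < N then cinner f (e n) else 0)" for n
    define x where "x = sqrt (\<Sum>n<N. (cmod (cinner f (e n)))\<^sup>2)"
    have x2: "x\<^sup>2 = (\<Sum>n<N. (cmod (cinner f (e n)))\<^sup>2)" by (simp add: x_def sum_nonneg)
    have x0: "0 \<le> x" by (simp add: x_def sum_nonneg)
    have fin: "(\<lambda>n. (cmod (c n))\<^sup>2) sums (\<Sum>n<N. (cmod (c n))\<^sup>2)"
      by (rule sums_finite) (auto simp: c_def)
    then have "ell2 c" by (auto simp: ell2_def dest: sums_summable)
    then have ent: "entry (Abs_ell2_seq c) = c" by (simp add: Abs_ell2_seq_inverse)
    have "(norm (Abs_ell2_seq c))\<^sup>2 = (\<Sum>n<N. (cmod (c n))\<^sup>2)"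
      unfolding norm_ell2_seq_square ent using fin by (rule sums_unique[symmetric])
    also have "\<dots> = x\<^sup>2" unfolding x2 by (intro sum.cong) (auto simp: c_def)
    finally have nc: "norm (Abs_ell2_seq c) = x"
      by (rule power2_eq_imp_eq) (use x0 in simp_all)
    have "complex_of_real (x\<^sup>2) = (\<Sum>n<N. cinner f (e n) * cnj (cinner f (e n)))"
      unfolding x2 of_real_sum complex_norm_square ..
    also have "\<dots> = cinner (S N (Abs_ell2_seq c)) f"
      unfolding S_def ent cinner_sum_left
      by (intro sum.cong) (auto simp: c_def cinner_scaleC_left cinner_commute[of "e _" f])
    finally have "x\<^sup>2 = cmod (cinner (S N (Abs_ell2_seq c)) f)"
      by (metis norm_of_real abs_of_nonneg zero_le_power2)
    also have "\<dots> \<le> norm (S N (Abs_ell2_seq c)) * norm f" by (rule cinner_Cauchy_Schwarz)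
    also have "\<dots> \<le> (M * x) * norm f"
      using M(2)[of N "Abs_ell2_seq c"] by (intro mult_right_mono) (auto simp: nc)
    finally have "x\<^sup>2 \<le> (M * norm f) * x" by (simp only: mult_ac)
    then have "x \<le> M * norm f"
      by (rule norm_sq_le_imp[OF _ x0]) (simp add: less_imp_le[OF M(1)])
    then have "x\<^sup>2 \<le> (M * norm f)\<^sup>2" using x0 by (rule power_mono)
    then show "(\<Sum>n<N. (cmod (cinner f (e n)))\<^sup>2) \<le> M\<^sup>2 * (norm f)\<^sup>2"
      by (simp add: x2 power_mult_distrib)
  qed (use M in simp)
qed

text \<open>
  Duality: a finite synthesis \<open>s\<close> satisfies
  \<open>\<parallel>s\<parallel>\<^sup>2 = \<Sum> c\<^sub>n \<langle>g\<^sub>n, s\<rangle> \<le> \<parallel>c\<parallel> \<surd>B \<parallel>s\<parallel>\<close>, so the blocks of the series are controlled by the blocks of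
  \<open>\<Sum> |c\<^sub>n|\<^sup>2\<close>.
\<close>

lemma bessel_synthesis_summable:
  assumes "bessel_sequence g" and c: "ell2 c"
  shows "summable (\<lambda>n. c n *\<^sub>C g n)"
proof -
  obtain B where B: "B > 0"
    "\<And>f I. finite I \<Longrightarrow> (\<Sum>n\<in>I. (cmod (cinner f (g n)))\<^sup>2) \<le> B * (norm f)\<^sup>2"
    using bessel_sequenceD[OF assms(1)] by metis
  have bound: "norm (\<Sum>n\<in>I. c n *\<^sub>C g n) \<le> sqrt B * L2_set (\<lambda>n. cmod (c n)) I" if I: "finite I" for I
  proof (rule norm_sq_le_imp)
    define s where "s = (\<Sum>n\<in>I. c n *\<^sub>C g n)"
    have "complex_of_real ((norm s)\<^sup>2) = (\<Sum>n\<in>I. c n * cinner (g n) s)"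
      unfolding cinner_self[symmetric] by (subst (1) s_def) (simp add: cinner_sum_left cinner_scaleC_left)
    then have "(norm s)\<^sup>2 = cmod (\<Sum>n\<in>I. c n * cinner (g n) s)"
      by (metis norm_of_real abs_of_nonneg zero_le_power2)
    also have "\<dots> \<le> (\<Sum>n\<in>I. \<bar>cmod (c n)\<bar> * \<bar>cmod (cinner s (g n))\<bar>)"
      by (rule sum_norm_le) (simp add: norm_mult cmod_cinner_commute)
    also have "\<dots> \<le> L2_set (\<lambda>n. cmod (c n)) I * L2_set (\<lambda>n. cmod (cinner s (g n))) I"
      by (rule L2_set_mult_ineq)
    also have "\<dots> \<le> L2_set (\<lambda>n. cmod (c n)) I * sqrt (B * (norm s)\<^sup>2)"
      unfolding L2_set_def[of "\<lambda>n. cmod (cinner s (g n))"]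
      by (intro mult_left_mono real_sqrt_le_mono B I L2_set_nonneg)
    finally show "(norm (\<Sum>n\<in>I. c n *\<^sub>C g n))\<^sup>2
      \<le> sqrt B * L2_set (\<lambda>n. cmod (c n)) I * norm (\<Sum>n\<in>I. c n *\<^sub>C g n)"
      by (simp add: s_def real_sqrt_mult mult_ac)
  qed (use B in \<open>auto intro!: mult_nonneg_nonneg\<close>)
  show ?thesis
    unfolding summable_Cauchy
  proof (intro allI impI)
    fix \<epsilon> :: real assume \<epsilon>: "\<epsilon> > 0"
    then have "\<epsilon>\<^sup>2 / B > 0" using B by simp
    then obtain N where N: "\<And>m n. m \<ge> N \<Longrightarrow> norm (\<Sum>k\<in>{m..<n}. (cmod (c k))\<^sup>2) < \<epsilon>\<^sup>2 / B"
      using c unfolding ell2_def summable_Cauchy by blast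
    have "norm (\<Sum>k\<in>{m..<n}. c k *\<^sub>C g k) < \<epsilon>" if "m \<ge> N" for m n
    proof -
      have "norm (\<Sum>k\<in>{m..<n}. c k *\<^sub>C g k) \<le> sqrt (B * (\<Sum>k\<in>{m..<n}. (cmod (c k))\<^sup>2))"
        using bound[of "{m..<n}"] by (simp add: L2_set_def real_sqrt_mult)
      also have "\<dots> < sqrt (\<epsilon>\<^sup>2)"
        using N[OF that, of n] B by (intro real_sqrt_less_mono) (simp add: field_simps sum_nonneg)
      finally show ?thesis using \<epsilon> by simp
    qed
    then show "\<exists>N. \<forall>m\<ge>N. \<forall>n. norm (\<Sum>k\<in>{m..<n}. c k *\<^sub>C g k) < \<epsilon>" by blast
  qed
qed

section \<open>Analysis, synthesis and expansions of an operator\<close>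

text \<open>
  For a Bessel sequence \<open>e\<close> this is the analysis operator, the adjoint of synthesis
  (\<open>inner_synthesis\<close> below). If the coefficients are not square-summable the value is unspecified.
\<close>

definition analysis :: "(nat \<Rightarrow> bergman) \<Rightarrow> bergman \<Rightarrow> ell2_seq" where
  "analysis e f = Abs_ell2_seq (\<lambda>n. cinner f (e n))"

lemma ell2_analysis: "bessel_sequence e \<Longrightarrow> ell2 (\<lambda>n. cinner f (e n))"
  by (auto simp: bessel_sequence_def ell2_def)

lemma entry_analysis: "bessel_sequence e \<Longrightarrow> entry (analysis e f) n = cinner f (e n)"
  using ell2_analysis[of e f] by (simp add: analysis_def Abs_ell2_seq_inverse)

lemma sums_cinner_left: "F sums s \<Longrightarrow> (\<lambda>n. cinner (F n) h) sums cinner s h"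
  by (rule bounded_linear.sums[OF bounded_linear_cinner_left])

lemma inner_synthesis:
  assumes e: "bessel_sequence e" and s: "(\<lambda>n. entry a n *\<^sub>C e n) sums s"
  shows "inner s f = inner (analysis e f) a"
proof -
  have "(\<lambda>n. Re (cinner (entry a n *\<^sub>C e n) f)) sums Re (cinner s f)"
    by (intro sums_Re sums_cinner_left s)
  then have "inner s f = (\<Sum>n. Re (cinner (entry a n *\<^sub>C e n) f))"
    by (simp add: sums_iff Re_cinner)
  also have "\<dots> = (\<Sum>n. Re (entry (analysis e f) n * cnj (entry a n)))"
    by (intro suminf_cong)
       (simp add: entry_analysis[OF e] cinner_scaleC_left cinner_commute[of "e _" f] )
  finally show ?thesis by (simp add: inner_ell2_seq.rep_eq)
qed

text \<open>
  Expand \<open>L x\<close> for \<open>x = L\<^sup>* f\<close> with coefficients \<open>a\<close> of norm at most \<open>C \<parallel>x\<parallel>\<close>. Then \<open>\<parallel>x\<parallel>\<^sup>2 = \<langle>L x, f\<rangle>\<close> is the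
  inner product of \<open>a\<close> with the analysis of \<open>f\<close>, hence at most \<open>C \<parallel>x\<parallel>\<close> times its norm.
\<close>

lemma norm_adjoint_le_analysis_if_atomic:
  assumes L: "bounded_clinear L" and atom: "atomic_system e L"
  obtains C where "C > 0" "\<And>f. norm (hilbert_adjoint L f) \<le> C * norm (analysis e f)"
proof -
  have e: "bessel_sequence e"
    using atom by (intro bessel_sequence_if_synthesis_converges) (auto simp: atomic_system_def)
  obtain C where C: "C > 0"
    "\<And>f. \<exists>a. ell2 a \<and> ell2_norm a \<le> C * norm f \<and> (\<lambda>n. a n *\<^sub>C e n) sums L f"
    using atom by (auto simp: atomic_system_def)
  have "norm (hilbert_adjoint L f) \<le> C * norm (analysis e f)" for f
  proof (rule norm_sq_le_imp)
    define x where "x = hilbert_adjoint L f"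
    obtain a0 where a0: "ell2 a0" "ell2_norm a0 \<le> C * norm x" "(\<lambda>n. a0 n *\<^sub>C e n) sums L x"
      using C by blast
    define a where "a = Abs_ell2_seq a0"
    have ent: "entry a = a0" using a0 by (simp add: a_def Abs_ell2_seq_inverse)
    have "(norm x)\<^sup>2 = inner (L x) f"
      using hilbert_adjoint[OF L, of x f] by (metis Re_cinner power2_norm_eq_inner x_def)
    also have "\<dots> = inner (analysis e f) a"
      using a0 by (intro inner_synthesis[OF e]) (simp add: ent)
    also have "\<dots> \<le> norm (analysis e f) * norm a" by (rule norm_cauchy_schwarz)
    also have "\<dots> \<le> norm (analysis e f) * (C * norm x)"
      using a0 by (intro mult_left_mono) (simp_all add: norm_ell2_seq.rep_eq[of a] ent)
    finally show "(norm (hilbert_adjoint L f))\<^sup>2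
        \<le> C * norm (analysis e f) * norm (hilbert_adjoint L f)"
      by (simp add: x_def mult_ac)
  qed (use C in auto)
  then show thesis using that C by blast
qed

lift_definition ell2_scaleC :: "complex \<Rightarrow> ell2_seq \<Rightarrow> ell2_seq" is "\<lambda>c a n. c * a n"
  by (rule ell2_cmult)

lemma inner_ell2_scaleC: "inner (ell2_scaleC c a) b = inner a (ell2_scaleC (cnj c) b)"
  by transfer (simp add: mult_ac)

lemma bounded_linear_ell2_scaleC: "bounded_linear (ell2_scaleC c)"
proof (rule bounded_linear_intro[where K="cmod c"])
  show "ell2_scaleC c (a + b) = ell2_scaleC c a + ell2_scaleC c b" for a b
    by transfer (simp add: algebra_simps)
  show "ell2_scaleC c (r *\<^sub>R a) = r *\<^sub>R ell2_scaleC c a" for r a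
    by transfer (simp add: mult_ac)
  show "norm (ell2_scaleC c a) \<le> norm a * cmod c" for a
  proof (rule power2_le_imp_le)
    have "(norm (ell2_scaleC c a))\<^sup>2 = (cmod c)\<^sup>2 * (\<Sum>n. (cmod (entry a n))\<^sup>2)"
      unfolding norm_ell2_seq_square ell2_scaleC.rep_eq norm_mult power_mult_distrib
      using ell2_entry[of a] by (intro suminf_mult) (simp add: ell2_def)
    then show "(norm (ell2_scaleC c a))\<^sup>2 \<le> (norm a * cmod c)\<^sup>2"
      by (simp add: norm_ell2_seq_square power_mult_distrib mult.commute)
  qed simp
qed

lemma linear_analysis:
  assumes "bessel_sequence e"
  shows "linear (analysis e)"
  by (rule linearI)
     (simp_all add: entry_inject[symmetric] fun_eq_iff entry_analysis[OF assms] plus_ell2_seq.rep_eq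
       scaleR_ell2_seq.rep_eq cinner_add_left scaleR_bergman_def cinner_scaleC_left)

lemma analysis_scaleC:
  assumes "bessel_sequence e"
  shows "analysis e (c *\<^sub>C f) = ell2_scaleC c (analysis e f)"
  by (simp add: entry_inject[symmetric] fun_eq_iff entry_analysis[OF assms] ell2_scaleC.rep_eq
      cinner_scaleC_left)

lemma subspace_closure:
  fixes S :: "'a::real_normed_vector set"
  assumes S: "subspace S"
  shows "subspace (closure S)"
proof (rule subspaceI)
  show "0 \<in> closure S" using subspace_0[OF S] closure_subset by blast
  fix x assume "x \<in> closure S"
  then obtain X where X: "\<And>n. X n \<in> S" "X \<longlonglongrightarrow> x" unfolding closure_sequential by blast
  show "r *\<^sub>R x \<in> closure S" for r
    unfolding closure_sequential
    by (intro exI[of _ "\<lambda>n. r *\<^sub>R X n"] conjI allI subspace_scale[OF S] X tendsto_intros)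
  fix y assume "y \<in> closure S"
  then obtain Y where Y: "\<And>n. Y n \<in> S" "Y \<longlonglongrightarrow> y" unfolding closure_sequential by blast
  show "x + y \<in> closure S"
    unfolding closure_sequential
    by (intro exI[of _ "\<lambda>n. X n + Y n"] conjI allI subspace_add[OF S] X Y tendsto_intros)
qed

text \<open>
  This is where a lower bound turns into an expansion, in the manner of Douglas' factorization lemma.
  For fixed \<open>f\<close> the functional \<open>h \<mapsto> \<langle>h, L f\<rangle> = \<langle>L\<^sup>* h, f\<rangle>\<close> is bounded by the norm of the analysis of
  \<open>h\<close>, so it is represented by a coefficient sequence \<open>a f\<close>. In the closure of the range of the
  analysis operator this sequence is unique, which makes \<open>f \<mapsto> a f\<close> linear; its entries are then bounded
  functionals and thus of the form \<open>\<langle>f, g\<^sub>n\<rangle>\<close>.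
\<close>

lemma dual_bessel_sequence:
  assumes L: "bounded_clinear L" and e: "bessel_sequence e"
    and bound: "\<And>f. norm (hilbert_adjoint L f) \<le> K * norm (analysis e f)" and K: "K > 0"
  obtains g where "bessel_sequence g" "\<And>f. (\<lambda>n. cinner f (g n) *\<^sub>C e n) sums L f"
proof -
  define R where "R = closure (range (analysis e))"
  note lin = linear_analysis[OF e]
  have subR: "subspace R"
    unfolding R_def using lin by (intro subspace_closure linear_subspace_image) auto
  have L_add: "L (f + g) = L f + L g" and L_scale: "L (c *\<^sub>C f) = c *\<^sub>C L f" for f g c
    using L by (auto simp: bounded_clinear_def linear_add[OF bounded_linear.linear])
  have rep: "\<exists>a\<in>R. (\<forall>h. inner (analysis e h) a = inner h (L f)) \<and> norm a \<le> K * norm f" for f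
  proof -
    have "\<bar>inner h (L f)\<bar> \<le> (K * norm f) * norm (analysis e h)" for h
    proof -
      have "inner h (L f) = inner f (hilbert_adjoint L h)"
        using hilbert_adjoint[OF L, of f h] by (metis Re_cinner inner_commute)
      also have "\<bar>\<dots>\<bar> \<le> norm f * norm (hilbert_adjoint L h)" by (rule Cauchy_Schwarz_ineq2)
      also have "\<dots> \<le> norm f * (K * norm (analysis e h))" by (intro mult_left_mono bound) auto
      finally show ?thesis by (simp add: mult_ac)
    qed
    moreover have "linear (\<lambda>h. inner h (L f))"
      by (rule linearI) (simp_all add: inner_left_distrib)
    ultimately obtain a where a: "a \<in> R" "\<And>h. inner (analysis e h) a = inner h (L f)"
      unfolding R_def using riesz_on_range[OF lin] by metis
    have "norm a \<le> K * norm f"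
    proof (rule closure_inner_bound)
      show "a \<in> closure (range (analysis e))" using a by (simp add: R_def)
      show "inner x a \<le> K * norm f * norm x" if "x \<in> range (analysis e)" for x
        using that a(2) \<open>\<And>h. \<bar>inner h (L f)\<bar> \<le> (K * norm f) * norm (analysis e h)\<close>
        by (auto simp: abs_le_iff)
    qed (use K in simp)
    then show ?thesis using a by blast
  qed
  then obtain a where aR: "\<And>f. a f \<in> R"
    and a: "\<And>f h. inner (analysis e h) (a f) = inner h (L f)"
    and na: "\<And>f. norm (a f) \<le> K * norm f" by metis
  have unique: "b = a f" if b: "b \<in> R" "\<And>h. inner (analysis e h) b = inner h (L f)" for b f
  proof -
    have "b - a f \<in> closure (range (analysis e))"
      using subspace_diff[OF subR b(1) aR] by (simp add: R_def)
    then have "norm (b - a f) \<le> 0"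
      by (rule closure_inner_bound) (auto simp: inner_diff_right a b)
    then show ?thesis by auto
  qed
  have a_add: "a (f + g) = a f + a g" for f g
    by (rule unique[symmetric]) (auto intro: subspace_add[OF subR] aR simp: inner_right_distrib a L_add)
  have a_scale: "a (c *\<^sub>C f) = ell2_scaleC c (a f)" for c f
  proof (rule unique[symmetric])
    have "ell2_scaleC c ` R \<subseteq> R"
      unfolding R_def
    proof (rule image_closure_subset)
      show "continuous_on (closure (range (analysis e))) (ell2_scaleC c)"
        by (rule bounded_linear.continuous_on[OF bounded_linear_ell2_scaleC continuous_on_id])
      show "ell2_scaleC c ` range (analysis e) \<subseteq> closure (range (analysis e))"
        by (auto simp: analysis_scaleC[OF e, symmetric] intro!: closure_subset[THEN subsetD])
    qed simp
    then show "ell2_scaleC c (a f) \<in> R" using aR by blast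
    show "inner (analysis e h) (ell2_scaleC c (a f)) = inner h (L (c *\<^sub>C f))" for h
    proof -
      have "inner (analysis e h) (ell2_scaleC c (a f)) = inner (analysis e (cnj c *\<^sub>C h)) (a f)"
        by (simp add: analysis_scaleC[OF e] inner_ell2_scaleC)
      also have "\<dots> = inner (cnj c *\<^sub>C h) (L f)" by (rule a)
      also have "\<dots> = inner h (L (c *\<^sub>C f))"
        by (simp add: Re_cinner[symmetric] cinner_scaleC_left cinner_scaleC_right L_scale)
      finally show ?thesis .
    qed
  qed
  \<comment> \<open>Each entry is a bounded complex-linear functional of \<open>f\<close>.\<close>
  have "\<exists>h. \<forall>f. entry (a f) n = cinner f h" for n
  proof (rule riesz_cinner[where \<phi>="\<lambda>f. entry (a f) n" and K=K])
    show "cmod (entry (a f) n) \<le> K * norm f" for f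
      using norm_entry_le[of "a f" n] na[of f] by simp
  qed (auto simp: a_add a_scale plus_ell2_seq.rep_eq ell2_scaleC.rep_eq)
  then obtain g where g: "\<And>f n. entry (a f) n = cinner f (g n)" by metis
  show thesis
  proof
    show "bessel_sequence g"
    proof (rule bessel_sequenceI[where B="K\<^sup>2"])
      show "(\<Sum>n<N. (cmod (cinner f (g n)))\<^sup>2) \<le> K\<^sup>2 * (norm f)\<^sup>2" for f N
        using sum_entry_le[of "a f" N] power_mono[OF na[of f], of 2] by (simp add: g power_mult_distrib)
    qed (use K in simp)
    show "(\<lambda>n. cinner f (g n) *\<^sub>C e n) sums L f" for f
    proof -
      obtain s where s: "(\<lambda>n. entry (a f) n *\<^sub>C e n) sums s"
        using bessel_synthesis_summable[OF e ell2_entry] by (auto simp: summable_def)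
      \<comment> \<open>The synthesis of \<open>a f\<close> agrees with \<open>L f\<close> in every inner product, by duality with analysis.\<close>
      have "\<forall>h. inner h s = inner h (L f)"
        using inner_synthesis[OF e s] a by (simp add: inner_commute)
      then have "s = L f" by (simp only: vector_eq_ldot)
      then show ?thesis using s by (simp add: g)
    qed
  qed
qed

text \<open>
  Both series are Bessel syntheses of square-summable coefficients and so converge; paired with an
  arbitrary vector they are complex conjugates of each other. The roles of \<open>L\<close> and its adjoint \<open>M\<close>
  are symmetric, so the lemma applies in both directions.
\<close>

lemma expansion_adjoint:
  assumes e: "bessel_sequence e" and g: "bessel_sequence g"
    and adj: "\<And>f h. cinner (L f) h = cinner f (M h)"
    and expand: "\<And>f. (\<lambda>n. cinner f (g n) *\<^sub>C e n) sums L f"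
  shows "(\<lambda>n. cinner h (e n) *\<^sub>C g n) sums M h"
proof -
  obtain s where s: "(\<lambda>n. cinner h (e n) *\<^sub>C g n) sums s"
    using bessel_synthesis_summable[OF g ell2_analysis[OF e]] by (auto simp: summable_def)
  have "s = M h"
  proof (rule bergman_eqI)
    fix f
    have "(\<lambda>n. cnj (cinner (cinner f (g n) *\<^sub>C e n) h)) sums cnj (cinner (L f) h)"
      unfolding sums_cnj by (rule sums_cinner_left[OF expand])
    also have "(\<lambda>n. cnj (cinner (cinner f (g n) *\<^sub>C e n) h)) = (\<lambda>n. cinner (cinner h (e n) *\<^sub>C g n) f)"
      by (simp add: cinner_scaleC_left fun_eq_iff mult.commute flip: cinner_commute)
    also have "cnj (cinner (L f) h) = cinner (M h) f"
      unfolding adj by (simp flip: cinner_commute)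
    finally show "cinner s f = cinner (M h) f"
      using sums_cinner_left[OF s, of f] sums_unique2 by blast
  qed
  with s show ?thesis by simp
qed

lemma atomic_if_expansion:
  assumes e: "bessel_sequence e" and g: "bessel_sequence g"
    and expand: "\<And>f. (\<lambda>n. cinner f (g n) *\<^sub>C e n) sums L f"
  shows "atomic_system e L"
proof -
  obtain B where B: "B > 0" "\<And>f. (\<Sum>n. (cmod (cinner f (g n)))\<^sup>2) \<le> B * (norm f)\<^sup>2"
    using g by (auto simp: bessel_sequence_def)
  have "ell2_norm (\<lambda>n. cinner f (g n)) \<le> sqrt B * norm f" for f
    using real_sqrt_le_mono[OF B(2)[of f]] by (simp add: ell2_norm_def real_sqrt_mult)
  then show ?thesis
    unfolding atomic_system_def
    using bessel_synthesis_summable[OF e] ell2_analysis[OF g] expand B(1)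
    by (metis real_sqrt_gt_zero)
qed

theorem corollary5:
  fixes L :: "bergman \<Rightarrow> bergman" and l :: "nat \<Rightarrow> complex"
  assumes "bounded_clinear L"
    and "\<And>n. l n \<in> ball 0 1"
    and "inj l"
  shows
    "(atomic_system (\<lambda>n. normalized_kernel (l n)) L \<longleftrightarrow> sampling_sequence l L) \<and>
     (atomic_system (\<lambda>n. normalized_kernel (l n)) L \<longleftrightarrow>
       bessel_sequence (\<lambda>n. normalized_kernel (l n)) \<and>
       (\<exists>g. bessel_sequence g \<and>
         (\<forall>f. (\<lambda>n. cinner f (g n) *\<^sub>C normalized_kernel (l n)) sums L f))) \<and>
     (atomic_system (\<lambda>n. normalized_kernel (l n)) L \<longleftrightarrow>
       (\<forall>f. summable (\<lambda>n. (1 - (cmod (l n))\<^sup>2)\<^sup>2 * (cmod (bergman_apply f (l n)))\<^sup>2)) \<and>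
       (\<exists>g. bessel_sequence g \<and>
         (\<forall>f. (\<lambda>n. (of_real (1 - (cmod (l n))\<^sup>2) * bergman_apply f (l n)) *\<^sub>C g n)
            sums hilbert_adjoint L f)))"
proof -
  define e where "e n = normalized_kernel (l n)" for n
  define Ls where "Ls = hilbert_adjoint L"
  have adj: "cinner (L f) h = cinner f (Ls h)" for f h
    unfolding Ls_def by (rule hilbert_adjoint[OF assms(1)])
  then have adj': "cinner (Ls f) h = cinner f (L h)" for f h by (metis cinner_commute)
  have coef: "of_real (1 - (cmod (l n))\<^sup>2) * bergman_apply f (l n) = cinner f (e n)" for f n
    unfolding e_def by (rule cinner_normalized_kernel[OF assms(2), symmetric])
  have coef_sq: "(1 - (cmod (l n))\<^sup>2)\<^sup>2 * (cmod (bergman_apply f (l n)))\<^sup>2 = (cmod (cinner f (e n)))\<^sup>2" for f n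
    unfolding coef[symmetric] norm_mult norm_of_real power_mult_distrib power2_abs ..
  have samp: "sampling_sequence l L \<longleftrightarrow> (\<exists>A>0. \<exists>B>0. \<forall>f.
     summable (\<lambda>n. (cmod (cinner f (e n)))\<^sup>2) \<and>
     A * (norm (Ls f))\<^sup>2 \<le> (\<Sum>n. (cmod (cinner f (e n)))\<^sup>2) \<and>
     (\<Sum>n. (cmod (cinner f (e n)))\<^sup>2) \<le> B * (norm f)\<^sup>2)"
    unfolding sampling_sequence_def Ls_def
    by (simp only: mult.commute[of "(cmod (bergman_apply _ _))\<^sup>2"] coef_sq)
  have norm_analysis: "(norm (analysis e f))\<^sup>2 = (\<Sum>n. (cmod (cinner f (e n)))\<^sup>2)" if "bessel_sequence e" for f
    unfolding norm_ell2_seq_square entry_analysis[OF that] ..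
  have i_ii: "sampling_sequence l L" if atom: "atomic_system e L"
  proof -
    have e: "bessel_sequence e"
      using atom by (intro bessel_sequence_if_synthesis_converges) (auto simp: atomic_system_def)
    obtain C where C: "C > 0" "\<And>f. norm (Ls f) \<le> C * norm (analysis e f)"
      unfolding Ls_def using norm_adjoint_le_analysis_if_atomic[OF assms(1) atom] by blast
    have "1 / C\<^sup>2 * (norm (Ls f))\<^sup>2 \<le> (\<Sum>n. (cmod (cinner f (e n)))\<^sup>2)" for f
      using power_mono[OF C(2)[of f], of 2] C(1)
      by (simp add: norm_analysis[OF e, symmetric] power_mult_distrib field_simps)
    moreover have "1 / C\<^sup>2 > 0" using C(1) by simp
    ultimately show ?thesis unfolding samp using e unfolding bessel_sequence_def by meson
  qed
  have ii_iii: "bessel_sequence e \<and> (\<exists>g. bessel_sequence g \<and> (\<forall>f. (\<lambda>n. cinner f (g n) *\<^sub>C e n) sums L f))"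
    if "sampling_sequence l L"
  proof -
    obtain A where A: "A > 0" "\<And>f. A * (norm (Ls f))\<^sup>2 \<le> (\<Sum>n. (cmod (cinner f (e n)))\<^sup>2)"
      and e: "bessel_sequence e"
      using \<open>sampling_sequence l L\<close> unfolding samp bessel_sequence_def by meson
    have "norm (Ls f) \<le> (1 / sqrt A) * norm (analysis e f)" for f
    proof (rule power2_le_imp_le)
      show "(norm (Ls f))\<^sup>2 \<le> (1 / sqrt A * norm (analysis e f))\<^sup>2"
        using A by (simp add: norm_analysis[OF e] power_mult_distrib power_divide field_simps)
    qed (use A in simp)
    then show ?thesis
      using dual_bessel_sequence[OF assms(1) e, of "1 / sqrt A"] e A(1) unfolding Ls_def
      by (metis real_sqrt_gt_zero zero_less_divide_1_iff)
  qed
  have iii_i: "atomic_system e L"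
    if "bessel_sequence e \<and> (\<exists>g. bessel_sequence g \<and> (\<forall>f. (\<lambda>n. cinner f (g n) *\<^sub>C e n) sums L f))"
    using that atomic_if_expansion by blast
  \<comment> \<open>For the kernels, square-summability of all coefficients is the Bessel property, and the two expansions are adjoint to each other.\<close>
  have iii_iv: "(bessel_sequence e \<and> (\<exists>g. bessel_sequence g \<and> (\<forall>f. (\<lambda>n. cinner f (g n) *\<^sub>C e n) sums L f)))
    \<longleftrightarrow> (\<forall>f. summable (\<lambda>n. (cmod (cinner f (e n)))\<^sup>2)) \<and>
      (\<exists>g. bessel_sequence g \<and> (\<forall>f. (\<lambda>n. cinner f (e n) *\<^sub>C g n) sums Ls f))"
  proof -
    have "bessel_sequence e \<longleftrightarrow> (\<forall>f. summable (\<lambda>n. (cmod (cinner f (e n)))\<^sup>2))"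
      using bessel_sequence_if_square_summable[of e] by (auto simp: bessel_sequence_def)
    then show ?thesis
      using expansion_adjoint[of e _ L Ls, OF _ _ adj] expansion_adjoint[of _ e Ls L, OF _ _ adj']
      by metis
  qed
  have eq_ii: "atomic_system e L \<longleftrightarrow> sampling_sequence l L"
    using i_ii ii_iii iii_i by blast
  have eq_iii: "atomic_system e L \<longleftrightarrow>
      bessel_sequence e \<and> (\<exists>g. bessel_sequence g \<and> (\<forall>f. (\<lambda>n. cinner f (g n) *\<^sub>C e n) sums L f))"
    using i_ii ii_iii iii_i by blast
  show ?thesis
    unfolding coef coef_sq e_def[symmetric] Ls_def[symmetric]
    by (intro conjI eq_ii eq_iii eq_iii[unfolded iii_iv])
qed

end
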